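(* Let $X_1,\ldots,X_n$ be independent random variables with values in a measurable space $(\mathscr X,\mathcal X)$ and let $\mathscr F$ be an at most countable class of functions on $\mathscr X$ with values in $[-1,1]$ which is VC-subgraph with dimension not larger than $V\ge1$. Let $$Z(\mathscr F)=\sup_{f\in\mathscr F}\Big|\sum_{i=1}^n\big(f(X_i)-\mathbb E[f(X_i)]\big)\Big|$$ and let $\sigma\in(0,1]$ satisfy $\sup_{f\in\mathscr F}\frac1n\sum_{i=1}^n\mathbb E[f^2(X_i)]\le\sigma^2$. Then $$\mathbb E[Z(\mathscr F)]\le 4.74\sqrt{nV\sigma^2\mathcal L(\sigma)}+90V\mathcal L(\sigma),\qquad\mathcal L(\sigma)=9.11+\log(1/\sigma^2).$$
   Context: A class of real functions on $\mathscr X$ is VC-subgraph with dimension not larger than $V$ if the family of subgraphs $\{(x,t)\in\mathscr X\times\mathbb R:\ f(x)>t\}$, $f$ in the class, shatters no finite subset of $\mathscr X\times\mathbb R$ of cardinality larger than $V$. *)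

theory Defs
  imports "HOL-Probability.Probability"
begin

definition shatters :: "'a set set \<Rightarrow> 'a set \<Rightarrow> bool" where
  "shatters C S \<longleftrightarrow> (\<forall>T\<subseteq>S. \<exists>A\<in>C. A \<inter> S = T)"

definition subgraph :: "'a set \<Rightarrow> ('a \<Rightarrow> real) \<Rightarrow> ('a \<times> real) set" where
  "subgraph X f = {(x, t). x \<in> X \<and> f x > t}"

definition VC_subgraph_le :: "'a set \<Rightarrow> ('a \<Rightarrow> real) set \<Rightarrow> real \<Rightarrow> bool" where
  "VC_subgraph_le X F V \<longleftrightarrow>
     (\<forall>S. S \<subseteq> X \<times> (UNIV :: real set) \<and> finite S \<and> real (card S) > V
          \<longrightarrow> \<not> shatters (subgraph X ` F) S)"

end

theory Submission
  imports Defs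
begin

text \<open>
  Symmetrization bounds \<open>E Z\<close> by twice the expected Rademacher average of the class at the sample.
  For a fixed sample \<open>x\<close> this average is controlled by chaining along nets of radii \<open>4\<^sup>-\<^sup>k sqrt S\<close>,
  where \<open>S\<close> is the largest empirical second moment: a packing of squared radius \<open>e\<close> has logarithmic
  size at most \<open>V (6 + 3/2 ln (1/e))\<close>, because greedily chosen points of the product with the real
  line separate all its subgraphs, to which the Sauer--Shelah lemma applies. The resulting bound is
  \<open>Y = 2.37 sqrt (n V g S)\<close> with the concave function \<open>g y = y (9.11 + ln (1/y))\<close>. Applied to the
  squares \<open>f\<^sup>2\<close>, the same chain gives \<open>E S \<le> \<sigma>\<^sup>2 + 4 E Y / n\<close>, and Jensen's inequality turns this into
  a quadratic inequality for \<open>E Y\<close>.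
\<close>

subsection \<open>Sauer--Shelah lemma and packing numbers\<close>

text \<open>The obstacle is that the level of localisation is random: chaining yields a bound in
  terms of the empirical quantity \<open>S\<close>, which is itself a supremum over the squared
  class. The chain is therefore run for \<open>\<phi>\<close> composed with the class, where
  \<open>\<phi>\<close> vanishes at 0 and is Lipschitz on [-1,1]. The nets live in the distances of
  the original functions and composition merely rescales increments, so one estimate covers the
  identity (Lipschitz constant 1) and squaring (constant 2). The 4 in the bound on the mean of
  \<open>S\<close> is this 2 times the 2 of symmetrization. Concavity of \<open>g\<close> is
  exploited through its tangent at \<sigma>^2, which makes the squared bound affine in
  \<open>S\<close>. All estimates are made for finite subclasses with a right-hand side free of
  their cardinality, so that the countable class is reached by monotone convergence. The final
  constants are 4.74 = 2 * 2.37 and an upper bound for 2 * 4 * 2.37^2.\<close>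

lemma card_le_card_shattered:
  assumes "finite S" "A \<subseteq> Pow S"
  shows "card A \<le> card {B. B \<subseteq> S \<and> shatters A B}"
  using assms
proof (induction S arbitrary: A rule: finite_induct)
  case empty
  then have "A = {} \<or> A = {{}}" by auto
  then show ?case
  proof
    assume "A = {{}}"
    then have "{B. B \<subseteq> {} \<and> shatters A B} = {{}}" by (auto simp: shatters_def)
    with \<open>A = {{}}\<close> show ?thesis by simp
  qed auto
next
  case (insert x S A)
  \<comment> \<open>Deleting \<open>x\<close> merges exactly those pairs of members that differ only
    in \<open>x\<close>. \<open>A0\<close> is the merged family, and \<open>A1\<close> lists the
    members of \<open>A0\<close> that are hit twice. Counting shattered sets, rather than sets of
    bounded size (Pajor's form), is what lets the induction close.\<close>
  define A0 where "A0 = (\<lambda>a. a - {x}) ` A"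
  define A1 where "A1 = {a \<in> A. x \<notin> a \<and> insert x a \<in> A}"
  have finA: "finite A" using insert.prems insert.hyps(1) by (meson finite_Pow_iff finite_insert finite_subset)
  have A0: "A0 \<subseteq> Pow S" and A1: "A1 \<subseteq> Pow S"
    using insert.prems by (auto simp: A0_def A1_def)
  have fin1: "finite A1" "finite A0" using finA by (auto simp: A0_def A1_def)
  have "card A = card A0 + card A1"
  proof -
    let ?N = "{a \<in> A. x \<notin> a}" and ?Y = "{a \<in> A. x \<in> a}"
    let ?Y' = "(\<lambda>a. a - {x}) ` ?Y"
    have "card A = card ?N + card ?Y"
      using finA by (subst card_Un_disjoint[symmetric]) (auto intro: arg_cong[where f = card])
    also have "card ?Y = card ?Y'"
      by (subst card_image) (auto simp: inj_on_def)
    also have "card ?N + card ?Y' = card (?N \<union> ?Y') + card (?N \<inter> ?Y')"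
      using finA by (intro card_Un_Int) auto
    also have "?N \<union> ?Y' = A0"
    proof -
      have "(\<lambda>a. a - {x}) ` ?N = (\<lambda>a. a) ` ?N" by (intro image_cong) auto
      moreover have "A = ?N \<union> ?Y" by auto
      then have "A0 = (\<lambda>a. a - {x}) ` ?N \<union> ?Y'" unfolding A0_def by (subst image_Un[symmetric]) simp
      ultimately show ?thesis by simp
    qed
    also have "?N \<inter> ?Y' = A1"
    proof -
      have "a \<in> ?Y'" if "a \<in> A1" for a
        using that by (intro image_eqI[of _ _ "insert x a"]) (auto simp: A1_def)
      then show ?thesis by (auto simp: A1_def insert_absorb)
    qed
    finally show ?thesis .
  qed
  also have "\<dots> \<le> card {B. B \<subseteq> S \<and> shatters A0 B} + card {B. B \<subseteq> S \<and> shatters A1 B}"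
    using insert.IH[OF A0] insert.IH[OF A1] by linarith
  also have "card {B. B \<subseteq> S \<and> shatters A1 B} = card (insert x ` {B. B \<subseteq> S \<and> shatters A1 B})"
    using insert.hyps(2) by (subst card_image) (auto simp: inj_on_def)
  also have "card {B. B \<subseteq> S \<and> shatters A0 B} + \<dots> =
      card ({B. B \<subseteq> S \<and> shatters A0 B} \<union> insert x ` {B. B \<subseteq> S \<and> shatters A1 B})"
    using insert.hyps by (intro card_Un_disjoint[symmetric]) auto
  \<comment> \<open>A set shattered by \<open>A1\<close> stays shattered by \<open>A\<close> after
    adding \<open>x\<close>, because every member of \<open>A1\<close> occurs in \<open>A\<close>
    both with and without \<open>x\<close>.\<close>
  also have "\<dots> \<le> card {B. B \<subseteq> insert x S \<and> shatters A B}"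
  proof (rule card_mono)
    show "finite {B. B \<subseteq> insert x S \<and> shatters A B}" using insert.hyps by simp
    have "shatters A B" if B: "B \<subseteq> S" "shatters A0 B" for B
      unfolding shatters_def
    proof (intro allI impI)
      fix T assume "T \<subseteq> B"
      then obtain a where "a \<in> A" "(a - {x}) \<inter> B = T"
        using B(2) unfolding shatters_def A0_def by blast
      moreover have "(a - {x}) \<inter> B = a \<inter> B" using B(1) insert.hyps by auto
      ultimately show "\<exists>a\<in>A. a \<inter> B = T" by blast
    qed
    moreover have "shatters A (insert x B)" if B: "B \<subseteq> S" "shatters A1 B" for B
      unfolding shatters_def
    proof (intro allI impI)
      fix T assume T: "T \<subseteq> insert x B"
      then obtain a where a: "a \<in> A1" "a \<inter> B = T - {x}"
        using B(2) unfolding shatters_def by (metis Diff_subset_conv insert_is_Un)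
      have xB: "x \<notin> B" using B insert.hyps by auto
      show "\<exists>a\<in>A. a \<inter> insert x B = T"
      proof (cases "x \<in> T")
        case True
        then have "insert x a \<inter> insert x B = T" using a(2) xB by auto
        moreover have "insert x a \<in> A" using a by (simp add: A1_def)
        ultimately show ?thesis by (rule bexI)
      next
        case False
        moreover have "a \<in> A" "x \<notin> a" using a by (simp_all add: A1_def)
        ultimately have "a \<inter> insert x B = T" using a(2) by auto
        then show ?thesis using \<open>a \<in> A\<close> by (rule bexI)
      qed
    qed
    ultimately show "{B. B \<subseteq> S \<and> shatters A0 B} \<union> insert x ` {B. B \<subseteq> S \<and> shatters A1 B}
        \<subseteq> {B. B \<subseteq> insert x S \<and> shatters A B}" by auto
  qed
  finally show ?case .
qed

lemma sum_Pow_power_card: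
  fixes z :: "'b::comm_semiring_1"
  assumes "finite P"
  shows "(\<Sum>B\<in>Pow P. z ^ card B) = (1 + z) ^ card P"
  using assms
proof (induction P rule: finite_induct)
  case (insert x P)
  have "(\<Sum>B\<in>Pow (insert x P). z ^ card B) = (\<Sum>B\<in>Pow P. z ^ card B) + (\<Sum>B\<in>insert x ` Pow P. z ^ card B)"
    using insert.hyps by (subst Pow_insert, intro sum.union_disjoint) auto
  also have "(\<Sum>B\<in>insert x ` Pow P. z ^ card B) = (\<Sum>B\<in>Pow P. z ^ card (insert x B))"
    using insert.hyps by (intro sum.reindex_cong[of "insert x"]) (auto simp: inj_on_def)
  also have "\<dots> = (\<Sum>B\<in>Pow P. z * z ^ card B)"
  proof (intro sum.cong refl)
    fix B assume "B \<in> Pow P"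
    then have "finite B" "x \<notin> B" using insert.hyps finite_subset by auto
    then show "z ^ card (insert x B) = z * z ^ card B" by simp
  qed
  finally show ?case using insert by (simp add: sum_distrib_left[symmetric] algebra_simps)
qed simp

text \<open>Give each set \<open>B\<close> the weight \<open>z ^ card B\<close>. At least
  \<open>card A\<close> sets are shattered and each weighs at least \<open>z powr V\<close>, while
  all subsets of \<open>P\<close> together weigh \<open>(1 + z) ^ card P\<close>, at most
  \<open>exp (z * card P)\<close>. This form allows a real \<open>V\<close> and leaves
  \<open>z\<close> free, to be balanced against \<open>card P\<close> later.\<close>

lemma ln_card_le_of_not_shattering:
  fixes V z :: real
  assumes P: "finite P" "A \<subseteq> Pow P" "A \<noteq> {}" and z: "0 < z" "z \<le> 1"
    and VC: "\<And>B. B \<subseteq> P \<Longrightarrow> shatters A B \<Longrightarrow> real (card B) \<le> V"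
  shows "ln (real (card A)) \<le> V * ln (1 / z) + z * real (card P)"
proof -
  have "finite A" using P finite_subset by blast
  then have pos: "card A > 0" using P by (simp add: card_gt_0_iff)
  let ?Q = "{B. B \<subseteq> P \<and> shatters A B}"
  have "real (card A) * z powr V \<le> real (card ?Q) * z powr V"
    using card_le_card_shattered[OF P(1,2)] by (intro mult_right_mono) auto
  also have "\<dots> = (\<Sum>B\<in>?Q. z powr V)" by simp
  also have "\<dots> \<le> (\<Sum>B\<in>?Q. z ^ card B)"
  proof (rule sum_mono)
    fix B assume "B \<in> ?Q"
    then have "z powr V \<le> z powr real (card B)"
      using VC z by (intro powr_mono') auto
    then show "z powr V \<le> z ^ card B" using z by (simp add: powr_realpow)
  qed
  also have "\<dots> \<le> (\<Sum>B\<in>Pow P. z ^ card B)"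
    using P z by (intro sum_mono2) auto
  also have "\<dots> = (1 + z) ^ card P" using P by (intro sum_Pow_power_card)
  also have "\<dots> \<le> exp z ^ card P" using z by (intro power_mono) auto
  also have "\<dots> = exp (z * real (card P))" by (simp add: exp_of_nat_mult[symmetric] mult.commute)
  finally have "ln (real (card A) * z powr V) \<le> z * real (card P)"
    using pos z by (subst ln_exp[symmetric], subst ln_le_cancel_iff) auto
  then have "ln (real (card A)) + V * ln z \<le> z * real (card P)"
    using pos z by (simp add: ln_mult ln_powr)
  then show ?thesis using z by (simp add: ln_div)
qed

section \<open>Packing numbers: few points that separate all subgraphs\<close>

text \<open>A greedy choice takes the place of random sampling: some \<open>\<omega>\<close>
  separates at least the average fraction \<open>p\<close> of what is still unseparated, so each
  choice shrinks the remainder by the factor \<open>1 - p\<close>.\<close>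

lemma greedy_separation:
  fixes sep :: "'p \<Rightarrow> 'u \<Rightarrow> bool" and p :: real
  assumes U: "finite U" and p: "p \<le> 1"
    and avg: "\<And>W. W \<subseteq> U \<Longrightarrow> W \<noteq> {} \<Longrightarrow> \<exists>\<omega>\<in>\<Omega>. p * real (card W) \<le> real (card {u\<in>W. sep \<omega> u})"
  shows "\<exists>P\<subseteq>\<Omega>. finite P \<and> card P \<le> m \<and>
    real (card {u\<in>U. \<forall>\<omega>\<in>P. \<not> sep \<omega> u}) \<le> (1 - p) ^ m * real (card U)"
proof (induction m)
  case 0
  show ?case by (intro exI[of _ "{}"]) auto
next
  case (Suc m)
  then obtain P where P: "P \<subseteq> \<Omega>" "finite P" "card P \<le> m"
    "real (card {u\<in>U. \<forall>\<omega>\<in>P. \<not> sep \<omega> u}) \<le> (1 - p) ^ m * real (card U)" by blast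
  let ?W = "{u\<in>U. \<forall>\<omega>\<in>P. \<not> sep \<omega> u}"
  show ?case
  proof (cases "?W = {}")
    case True
    then have "real (card ?W) \<le> (1 - p) ^ Suc m * real (card U)" using p by (simp only: card.empty) simp
    then show ?thesis using P by (intro exI[of _ P]) auto
  next
    case False
    with avg[of ?W] obtain \<omega> where \<omega>: "\<omega> \<in> \<Omega>" "p * real (card ?W) \<le> real (card {u\<in>?W. sep \<omega> u})"
      by auto
    have "{u\<in>U. \<forall>\<omega>'\<in>insert \<omega> P. \<not> sep \<omega>' u} = ?W - {u\<in>?W. sep \<omega> u}" by auto
    then have "card {u\<in>U. \<forall>\<omega>'\<in>insert \<omega> P. \<not> sep \<omega>' u} = card ?W - card {u\<in>?W. sep \<omega> u}"
      using U by (simp only:) (intro card_Diff_subset, auto)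
    moreover have "card {u\<in>?W. sep \<omega> u} \<le> card ?W" using U by (intro card_mono) auto
    ultimately have "real (card {u\<in>U. \<forall>\<omega>'\<in>insert \<omega> P. \<not> sep \<omega>' u}) = real (card ?W) - real (card {u\<in>?W. sep \<omega> u})"
      by simp
    also have "\<dots> \<le> (1 - p) * real (card ?W)" using \<omega> by (simp add: algebra_simps)
    also have "\<dots> \<le> (1 - p) * ((1 - p) ^ m * real (card U))" using P p by (intro mult_left_mono) auto
    finally show ?thesis using P \<omega>
      by (intro exI[of _ "insert \<omega> P"]) (auto simp: card_insert_if algebra_simps)
  qed
qed

text \<open>Averaging over \<open>i\<close> and over levels \<open>t\<close> uniform in \<open>[-1,1]\<close>: the subgraphs of \<open>f\<close> and \<open>g\<close>
  differ at \<open>(x i, t)\<close> with probability \<open>\<bar>f (x i) - g (x i)\<bar> / 2 \<ge> (f (x i) - g (x i))\<^sup>2 / 4\<close>.\<close>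

lemma exists_separating_level:
  fixes x :: "'i \<Rightarrow> 'a" and e :: real
  assumes I: "finite I" and W: "finite W" "W \<noteq> {}"
    and bnd: "\<And>f g i. (f, g) \<in> W \<Longrightarrow> i \<in> I \<Longrightarrow> \<bar>f (x i)\<bar> \<le> 1 \<and> \<bar>g (x i)\<bar> \<le> 1"
    and sep: "\<And>f g. (f, g) \<in> W \<Longrightarrow> e * real (card I) < (\<Sum>i\<in>I. (f (x i) - g (x i))\<^sup>2)"
  shows "\<exists>i\<in>I. \<exists>t. e / 4 * real (card W) \<le> real (card {u\<in>W. (t < fst u (x i)) \<noteq> (t < snd u (x i))})"
proof (rule ccontr)
  assume neg: "\<not> ?thesis"
  \<comment> \<open>These are the levels at which exactly one of the two subgraphs contains the
    point over \<open>x i\<close>. The interval is half-open because the condition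
    \<open>t < f\<close> is strict; its length is the distance of the two values.\<close>
  define D where "D i u = {min (fst u (x i)) (snd u (x i)) ..< max (fst u (x i)) (snd u (x i))}"
    for i :: 'i and u :: "('a \<Rightarrow> real) \<times> ('a \<Rightarrow> real)"
  have count: "real (card {u\<in>W. (t < fst u (x i)) \<noteq> (t < snd u (x i))}) = (\<Sum>u\<in>W. indicator (D i u) t)" for i t
  proof -
    have "(\<Sum>u\<in>W. indicator (D i u) t) = (\<Sum>u\<in>W. if (t < fst u (x i)) \<noteq> (t < snd u (x i)) then 1 else (0::real))"
      by (intro sum.cong refl) (auto simp: D_def indicator_def)
    also have "\<dots> = real (card {u\<in>W. (t < fst u (x i)) \<noteq> (t < snd u (x i))})"
      using W by (simp add: sum.If_cases Int_def)
    finally show ?thesis by simp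
  qed
  have int: "integrable lborel (\<lambda>t. \<Sum>i\<in>I. \<Sum>u\<in>W. indicator (D i u) t :: real)"
    by (intro Bochner_Integration.integrable_sum) (auto simp: D_def)
  have "(\<Sum>i\<in>I. \<Sum>u\<in>W. \<bar>fst u (x i) - snd u (x i)\<bar>) = (\<integral>t. (\<Sum>i\<in>I. \<Sum>u\<in>W. indicator (D i u) t) \<partial>lborel)"
    by (auto simp: D_def intro!: sum.cong)
  \<comment> \<open>Levels outside [-1,1] separate nothing. The integral over the remaining interval
    of length 2 turns the assumed \<open>e / 4\<close> into the \<open>e / 2\<close> that
    contradicts the separation.\<close>
  also have "\<dots> \<le> (\<integral>t. real (card I) * (e / 4 * real (card W)) * indicator {-1..1::real} t \<partial>lborel)"
  proof (rule Bochner_Integration.integral_mono)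
    show "integrable lborel (\<lambda>t. \<Sum>i\<in>I. \<Sum>u\<in>W. indicator (D i u) t :: real)" by (fact int)
    show "integrable lborel (\<lambda>t. real (card I) * (e / 4 * real (card W)) * indicator {-1..1::real} t)" by simp
    fix t :: real
    show "(\<Sum>i\<in>I. \<Sum>u\<in>W. indicator (D i u) t) \<le> real (card I) * (e / 4 * real (card W)) * indicator {-1..1} t"
    proof (cases "t \<in> {-1..1}")
      case True
      have "(\<Sum>i\<in>I. \<Sum>u\<in>W. indicator (D i u) t) \<le> (\<Sum>i\<in>I. e / 4 * real (card W))"
        using neg by (intro sum_mono) (auto simp: count[symmetric] not_le less_imp_le)
      then show ?thesis using True by simp
    next
      case False
      have "(\<Sum>i\<in>I. \<Sum>u\<in>W. indicator (D i u) t) = (\<Sum>i\<in>I. \<Sum>u\<in>W. (0::real))"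
      proof (intro sum.cong refl)
        fix i u assume "i \<in> I" "u \<in> W"
        then show "indicator (D i u) t = (0::real)"
          using bnd[of "fst u" "snd u" i] False by (auto simp: D_def indicator_def)
      qed
      then show ?thesis using False by simp
    qed
  qed
  also have "\<dots> = real (card W) * (e * real (card I) / 2)" by simp
  also have "\<dots> = (\<Sum>u\<in>W. e * real (card I) / 2)" by simp
  also have "\<dots> < (\<Sum>u\<in>W. (\<Sum>i\<in>I. (fst u (x i) - snd u (x i))\<^sup>2) / 2)"
    using W sep by (intro sum_strict_mono) auto
  also have "\<dots> \<le> (\<Sum>u\<in>W. \<Sum>i\<in>I. \<bar>fst u (x i) - snd u (x i)\<bar>)"
    unfolding sum_divide_distrib
  proof (intro sum_mono)
    fix u i assume "u \<in> W" "i \<in> I"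
    then have "\<bar>fst u (x i) - snd u (x i)\<bar> \<le> 2" using bnd[of "fst u" "snd u" i] by auto
    then have "\<bar>fst u (x i) - snd u (x i)\<bar> * \<bar>fst u (x i) - snd u (x i)\<bar> \<le> 2 * \<bar>fst u (x i) - snd u (x i)\<bar>"
      by (intro mult_right_mono) auto
    then show "(fst u (x i) - snd u (x i))\<^sup>2 / 2 \<le> \<bar>fst u (x i) - snd u (x i)\<bar>"
      by (simp add: power2_eq_square abs_mult_self_eq)
  qed
  also have "\<dots> = (\<Sum>i\<in>I. \<Sum>u\<in>W. \<bar>fst u (x i) - snd u (x i)\<bar>)" by (rule sum.swap)
  finally show False by simp
qed

lemma VC_subgraph_le_subset: "VC_subgraph_le X F V \<Longrightarrow> T \<subseteq> F \<Longrightarrow> VC_subgraph_le X T V"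
  unfolding VC_subgraph_le_def shatters_def by (meson image_mono subsetD)

text \<open>The number of separating points grows with the logarithm of the packing size, so
  Sauer--Shelah gives an inequality with that logarithm on both sides. With the weight
  \<open>z = e / 24\<close> the term that returns is one third of it; moving it to the left produces
  the factor 3/2.\<close>

lemma ln_packing_le:
  fixes x :: "'i \<Rightarrow> 'a" and e V :: real
  assumes I: "finite I" and x: "\<And>i. i \<in> I \<Longrightarrow> x i \<in> X"
    and T: "finite T" and VC: "VC_subgraph_le X T V" and V: "1 \<le> V"
    and bnd: "\<And>f i. f \<in> T \<Longrightarrow> i \<in> I \<Longrightarrow> \<bar>f (x i)\<bar> \<le> 1"
    and e: "0 < e" "e \<le> 1"
    and sep: "\<And>f g. f \<in> T \<Longrightarrow> g \<in> T \<Longrightarrow> f \<noteq> g \<Longrightarrow> e * real (card I) < (\<Sum>i\<in>I. (f (x i) - g (x i))\<^sup>2)"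
  shows "ln (real (card T)) \<le> V * (6 + 3 / 2 * ln (1 / e))"
proof (cases "card T \<le> 1")
  case True
  then have "ln (real (card T)) = 0" by (cases "card T") auto
  then show ?thesis using V e by simp
next
  case False
  define N where "N = real (card T)"
  have N: "N > 1" using False by (simp add: N_def)
  define U where "U = {(f, g). f \<in> T \<and> g \<in> T \<and> f \<noteq> g}"
  have UT: "U \<subseteq> T \<times> T" by (auto simp: U_def)
  have finU: "finite U" using finite_subset[OF UT] T by simp
  \<comment> \<open>The missing diagonal makes \<open>card U < N\<^sup>2\<close> strict, and this
    strictness brings the number of unseparated pairs below one.\<close>
  obtain f0 where "f0 \<in> T" using False by (cases "T = {}") auto
  then have "(f0, f0) \<in> T \<times> T - U" by (simp add: U_def)
  then have "U \<subset> T \<times> T" using UT by blast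
  then have "card U < card (T \<times> T)" using T by (intro psubset_card_mono) auto
  then have cardU: "real (card U) < N\<^sup>2"
    by (simp add: N_def power2_eq_square card_cartesian_product flip: of_nat_mult)
  \<comment> \<open>With this many points the unseparated fraction is at most exp(-e m / 4), hence
    at most 1 / N^2, which beats the number of ordered pairs.\<close>
  define m where "m = nat \<lceil>8 * ln N / e\<rceil>"
  have m: "8 * ln N / e \<le> real m" "real m \<le> 8 * ln N / e + 1"
  proof -
    have "0 \<le> 8 * ln N / e" using N e by simp
    then show "8 * ln N / e \<le> real m" "real m \<le> 8 * ln N / e + 1"
      unfolding m_def by linarith+
  qed
  define S where "S p u \<longleftrightarrow> (snd p < fst u (fst p)) \<noteq> (snd p < snd u (fst p))"
    for p :: "'a \<times> real" and u :: "('a \<Rightarrow> real) \<times> ('a \<Rightarrow> real)"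
  have "\<exists>P\<subseteq>(x ` I) \<times> UNIV. finite P \<and> card P \<le> m \<and>
      real (card {u\<in>U. \<forall>p\<in>P. \<not> S p u}) \<le> (1 - e / 4) ^ m * real (card U)"
  proof (rule greedy_separation[OF finU])
    show "e / 4 \<le> 1" using e by simp
    fix W assume W: "W \<subseteq> U" "W \<noteq> {}"
    have "\<exists>i\<in>I. \<exists>t. e / 4 * real (card W) \<le> real (card {u\<in>W. (t < fst u (x i)) \<noteq> (t < snd u (x i))})"
      using W finU I bnd sep by (intro exists_separating_level) (auto simp: U_def intro: finite_subset)
    then obtain i t where it: "i \<in> I" "e / 4 * real (card W) \<le> real (card {u\<in>W. (t < fst u (x i)) \<noteq> (t < snd u (x i))})"
      by blast
    then show "\<exists>p\<in>x ` I \<times> UNIV. e / 4 * real (card W) \<le> real (card {u\<in>W. S p u})"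
      by (intro bexI[of _ "(x i, t)"]) (auto simp: S_def)
  qed
  then obtain P where P: "P \<subseteq> (x ` I) \<times> UNIV" "finite P" "card P \<le> m"
    "real (card {u\<in>U. \<forall>p\<in>P. \<not> S p u}) \<le> (1 - e / 4) ^ m * real (card U)" by blast
  have "(1 - e / 4) ^ m \<le> exp (- (e / 4)) ^ m"
    using e exp_ge_add_one_self[of "- (e / 4)"] by (intro power_mono) auto
  also have "\<dots> = exp (- (e / 4 * real m))" by (simp add: exp_of_nat_mult[symmetric] mult.commute)
  also have "\<dots> \<le> exp (- (2 * ln N))"
    using m e by (simp add: field_simps)
  also have "\<dots> = 1 / N\<^sup>2"
    using N by (simp add: exp_minus exp_double inverse_eq_divide)
  finally have "(1 - e / 4) ^ m * real (card U) \<le> 1 / N\<^sup>2 * real (card U)" by (intro mult_right_mono) auto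
  also have "\<dots> < 1" using N cardU by simp
  finally have "card {u\<in>U. \<forall>p\<in>P. \<not> S p u} = 0" using P(4) by linarith
  then have all: "{u\<in>U. \<forall>p\<in>P. \<not> S p u} = {}" using finU by simp
  define A where "A = (\<lambda>f. subgraph X f \<inter> P) ` T"
  have PX: "P \<subseteq> X \<times> UNIV" using P(1) x by auto
  have "inj_on (\<lambda>f. subgraph X f \<inter> P) T"
  proof (rule inj_onI, rule ccontr)
    fix f g assume fg: "f \<in> T" "g \<in> T" "subgraph X f \<inter> P = subgraph X g \<inter> P" "f \<noteq> g"
    then have "(f, g) \<in> U" by (simp add: U_def)
    with all obtain p where p: "p \<in> P" "S p (f, g)" by blast
    then have "(p \<in> subgraph X f) \<noteq> (p \<in> subgraph X g)"
      using PX by (cases p) (auto simp: S_def subgraph_def)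
    then show False using fg(3) p(1) by blast
  qed
  then have cardA: "card A = card T" unfolding A_def by (rule card_image)
  have "ln (real (card A)) \<le> V * ln (1 / (e / 24)) + e / 24 * real (card P)"
  proof (rule ln_card_le_of_not_shattering)
    show "A \<noteq> {}" using False by (auto simp: A_def)
    fix B assume B: "B \<subseteq> P" "shatters A B"
    have "shatters (subgraph X ` T) B"
      unfolding shatters_def
    proof (intro allI impI)
      fix C assume "C \<subseteq> B"
      then obtain f where "f \<in> T" "subgraph X f \<inter> P \<inter> B = C"
        using B(2) unfolding shatters_def A_def by blast
      moreover have "subgraph X f \<inter> P \<inter> B = subgraph X f \<inter> B" using B(1) by auto
      ultimately show "\<exists>A\<in>subgraph X ` T. A \<inter> B = C" by auto
    qed
    moreover have "B \<subseteq> X \<times> UNIV" "finite B" using B(1) P(2) PX finite_subset by auto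
    ultimately show "real (card B) \<le> V" using VC unfolding VC_subgraph_le_def by (meson not_le)
  qed (use P e in \<open>auto simp: A_def\<close>)
  also have "e / 24 * real (card P) \<le> e / 24 * (8 * ln N / e + 1)"
    using P(3) m(2) e by (intro mult_left_mono) auto
  also have "\<dots> = ln N / 3 + e / 24" using e by (simp add: field_simps)
  finally have 1: "ln N \<le> V * ln (1 / (e / 24)) + ln N / 3 + e / 24" by (simp add: cardA N_def)
  \<comment> \<open>Numerical budget for the constant 6: \<open>ln 24 \<le> 7/2\<close> uses 3/2 *
    7/2 = 21/4, and the remaining 3/4 covers 3/2 * e/24.\<close>
  have "ln (24::real) \<le> ln (2 ^ 5)" by (subst ln_le_cancel_iff) auto
  also have "\<dots> = 5 * ln 2" by (subst ln_realpow) auto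
  also have "\<dots> \<le> 7 / 2" using ln2_le_25_over_36 by simp
  finally have ln24: "ln (24::real) \<le> 7 / 2" .
  have "ln (1 / (e / 24)) = ln 24 + ln (1 / e)" using e by (simp add: ln_div)
  then have "V * ln (1 / (e / 24)) \<le> V * (7 / 2 + ln (1 / e))"
    using ln24 V by (intro mult_left_mono) auto
  moreover have "e / 24 \<le> V / 24" using e V by simp
  moreover have "V * (6 + 3 / 2 * ln (1 / e)) = 3 / 2 * (V * (7 / 2 + ln (1 / e))) + 3 / 4 * V" by (simp add: algebra_simps)
  ultimately have "ln N \<le> V * (6 + 3 / 2 * ln (1 / e))"
    using 1 V by linarith
  then show ?thesis by (simp add: N_def)
qed

subsection \<open>Rademacher averages and chaining\<close>

text \<open>A fair coin on {0, 1}, centred and scaled by \<open>2 * y\<close>, is a random sign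
  scaled by \<open>y\<close>, so the analytic part of Hoeffding's lemma with parameter 1/2 applies.
  It is invoked for positive \<open>y\<close>; evenness of \<open>cosh\<close> gives the negative
  case.\<close>

lemma cosh_le_exp_half_square: "cosh (y::real) \<le> exp (y\<^sup>2 / 2)"
proof -
  have pos: "cosh y \<le> exp (y\<^sup>2 / 2)" if y: "y > 0" for y :: real
  proof -
    have "- (2 * y) * (1/2) + ln (1 + (1/2) * (exp (2 * y) - 1)) \<le> (2 * y)\<^sup>2 / 8"
      using y by (intro Hoeffdings_lemma_aux) auto
    moreover have "1 + (1/2) * (exp (2 * y) - 1) = exp y * cosh y"
      by (simp add: cosh_def field_simps exp_minus mult_exp_exp)
    moreover have "ln (exp y * cosh y) = y + ln (cosh y)" by (simp add: ln_mult)
    ultimately have "ln (cosh y) \<le> y\<^sup>2 / 2" by (simp add: power_mult_distrib)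
    then show ?thesis using cosh_real_pos[of y] by (metis exp_le_cancel_iff exp_ln)
  qed
  consider "y > 0" | "y = 0" | "- y > 0" by linarith
  then show ?thesis using pos[of y] pos[of "- y"] by cases auto
qed

text \<open>Expectation over independent random signs, encoded as a finite average over the cube:
  linearity and measurability in the sample become facts about finite sums, and no second
  probability space has to be carried along.\<close>

definition rademacher_avg :: "'i set \<Rightarrow> (('i \<Rightarrow> real) \<Rightarrow> real) \<Rightarrow> real" where
  "rademacher_avg I h = (\<Sum>\<epsilon>\<in>PiE I (\<lambda>_. {-1, 1}). h \<epsilon>) / 2 ^ card I"

lemma rademacher_avg_mono:
  "(\<And>\<epsilon>. \<epsilon> \<in> PiE I (\<lambda>_. {-1, 1}) \<Longrightarrow> h \<epsilon> \<le> k \<epsilon>) \<Longrightarrow> rademacher_avg I h \<le> rademacher_avg I k"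
  unfolding rademacher_avg_def by (intro divide_right_mono sum_mono) auto

lemma rademacher_avg_add:
  "rademacher_avg I (\<lambda>\<epsilon>. h \<epsilon> + k \<epsilon>) = rademacher_avg I h + rademacher_avg I k"
  by (simp add: rademacher_avg_def sum.distrib add_divide_distrib)

lemma rademacher_avg_cmult: "rademacher_avg I (\<lambda>\<epsilon>. c * h \<epsilon>) = c * rademacher_avg I h"
  by (simp add: rademacher_avg_def sum_distrib_left)

lemma rademacher_avg_sum: "rademacher_avg I (\<lambda>\<epsilon>. \<Sum>j\<in>T. h j \<epsilon>) = (\<Sum>j\<in>T. rademacher_avg I (h j))"
  unfolding rademacher_avg_def by (subst sum.swap) (simp add: sum_divide_distrib)

lemma rademacher_avg_const: "finite I \<Longrightarrow> rademacher_avg I (\<lambda>\<epsilon>. c) = c"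
  by (simp add: rademacher_avg_def card_PiE numeral_eq_Suc)

lemma rademacher_avg_exp_le:
  assumes "finite I"
  shows "rademacher_avg I (\<lambda>\<epsilon>. exp (\<Sum>i\<in>I. \<epsilon> i * a i)) \<le> exp ((\<Sum>i\<in>I. (a i)\<^sup>2) / 2)"
proof -
  have "rademacher_avg I (\<lambda>\<epsilon>. exp (\<Sum>i\<in>I. \<epsilon> i * a i)) = (\<Prod>i\<in>I. \<Sum>s\<in>{-1, 1}. exp (s * a i)) / 2 ^ card I"
    using assms by (subst prod_sum_PiE) (simp_all add: rademacher_avg_def exp_sum)
  also have "\<dots> = (\<Prod>i\<in>I. cosh (a i))"
    by (simp add: cosh_def prod_dividef add.commute)
  also have "\<dots> \<le> (\<Prod>i\<in>I. exp ((a i)\<^sup>2 / 2))"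
    by (intro prod_mono) (auto simp: cosh_le_exp_half_square)
  also have "\<dots> = exp ((\<Sum>i\<in>I. (a i)\<^sup>2) / 2)"
    using assms by (simp add: exp_sum sum_divide_distrib)
  finally show ?thesis .
qed

text \<open>Maximal inequality by exponential moments. The 2 inside the logarithm comes from
  bounding the exponential of an absolute value by the sum over both signs.\<close>

lemma rademacher_avg_Max_le:
  fixes a :: "'j \<Rightarrow> 'i \<Rightarrow> real" and s :: real
  assumes I: "finite I" and T: "finite T" "T \<noteq> {}" and s: "0 < s"
    and a: "\<And>j. j \<in> T \<Longrightarrow> (\<Sum>i\<in>I. (a j i)\<^sup>2) \<le> s\<^sup>2"
  shows "rademacher_avg I (\<lambda>\<epsilon>. Max ((\<lambda>j. \<bar>\<Sum>i\<in>I. \<epsilon> i * a j i\<bar>) ` T)) \<le> s * sqrt (2 * ln (2 * real (card T)))"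
proof -
  define Y where "Y \<epsilon> = Max ((\<lambda>j. \<bar>\<Sum>i\<in>I. \<epsilon> i * a j i\<bar>) ` T)" for \<epsilon>
  define m where "m = rademacher_avg I Y"
  define N where "N = real (card T)"
  have N: "N \<ge> 1" using T by (simp add: N_def Suc_le_eq card_gt_0_iff)
  \<comment> \<open>The minimiser of \<open>ln (2 * N) / l + l * s\<^sup>2 / 2\<close>, at which the
    two terms agree.\<close>
  define l where "l = sqrt (2 * ln (2 * N)) / s"
  have lnpos: "ln (2 * N) > 0" using N by simp
  have l: "l > 0" using lnpos s by (simp add: l_def)
  \<comment> \<open>Jensen's inequality for \<open>exp\<close> through its tangent at the mean
    \<open>l * m\<close>: the affine function averages to the value \<open>exp (l * m)\<close> and
    lies below \<open>exp (l * Y \<epsilon>)\<close>.\<close>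
  have "exp (l * m) = rademacher_avg I (\<lambda>\<epsilon>. exp (l * m) * (1 - l * m) + (exp (l * m) * l) * Y \<epsilon>)"
    using I unfolding rademacher_avg_add rademacher_avg_cmult
    by (simp add: rademacher_avg_const m_def[symmetric] algebra_simps)
  also have "\<dots> \<le> rademacher_avg I (\<lambda>\<epsilon>. \<Sum>j\<in>T. exp (\<Sum>i\<in>I. \<epsilon> i * (l * a j i)) + exp (\<Sum>i\<in>I. \<epsilon> i * (- l * a j i)))"
  proof (rule rademacher_avg_mono)
    fix \<epsilon> :: "'i \<Rightarrow> real"
    have "exp (l * m) * (1 - l * m) + (exp (l * m) * l) * Y \<epsilon> = exp (l * m) * (1 + (l * Y \<epsilon> - l * m))"
      by (simp add: algebra_simps)
    also have "\<dots> \<le> exp (l * m) * exp (l * Y \<epsilon> - l * m)" by (intro mult_left_mono exp_ge_add_one_self) auto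
    also have "\<dots> = exp (l * Y \<epsilon>)" by (simp add: exp_add[symmetric])
    also have "\<dots> \<le> (\<Sum>j\<in>T. exp (\<Sum>i\<in>I. \<epsilon> i * (l * a j i)) + exp (\<Sum>i\<in>I. \<epsilon> i * (- l * a j i)))"
    proof -
      have "Y \<epsilon> \<in> (\<lambda>j. \<bar>\<Sum>i\<in>I. \<epsilon> i * a j i\<bar>) ` T" unfolding Y_def using T by (intro Max_in) auto
      then obtain j where j: "j \<in> T" "Y \<epsilon> = \<bar>\<Sum>i\<in>I. \<epsilon> i * a j i\<bar>" by blast
      have 1: "(\<Sum>i\<in>I. \<epsilon> i * (l * a j i)) = l * (\<Sum>i\<in>I. \<epsilon> i * a j i)"
        and 2: "(\<Sum>i\<in>I. \<epsilon> i * (- l * a j i)) = - (l * (\<Sum>i\<in>I. \<epsilon> i * a j i))"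
        by (simp_all add: sum_distrib_left sum_negf[symmetric] algebra_simps)
      have "exp (l * Y \<epsilon>) \<le> exp (\<Sum>i\<in>I. \<epsilon> i * (l * a j i)) + exp (\<Sum>i\<in>I. \<epsilon> i * (- l * a j i))"
        unfolding 1 2 j(2) by (auto simp: abs_if)
      also have "\<dots> \<le> (\<Sum>j\<in>T. exp (\<Sum>i\<in>I. \<epsilon> i * (l * a j i)) + exp (\<Sum>i\<in>I. \<epsilon> i * (- l * a j i)))"
        using j(1) T by (intro member_le_sum[of j T]) (auto intro!: add_nonneg_nonneg)
      finally show ?thesis .
    qed
    finally show "exp (l * m) * (1 - l * m) + (exp (l * m) * l) * Y \<epsilon> \<le> \<dots>" .
  qed
  also have "\<dots> = (\<Sum>j\<in>T. rademacher_avg I (\<lambda>\<epsilon>. exp (\<Sum>i\<in>I. \<epsilon> i * (l * a j i))) + rademacher_avg I (\<lambda>\<epsilon>. exp (\<Sum>i\<in>I. \<epsilon> i * (- l * a j i))))"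
    by (simp only: rademacher_avg_sum rademacher_avg_add)
  also have "\<dots> \<le> (\<Sum>j\<in>T. exp (l\<^sup>2 * s\<^sup>2 / 2) + exp (l\<^sup>2 * s\<^sup>2 / 2))"
  proof (intro sum_mono add_mono)
    fix j assume j: "j \<in> T"
    have *: "rademacher_avg I (\<lambda>\<epsilon>. exp (\<Sum>i\<in>I. \<epsilon> i * (c * a j i))) \<le> exp (l\<^sup>2 * s\<^sup>2 / 2)" if "c\<^sup>2 = l\<^sup>2" for c
    proof -
      have "(\<Sum>i\<in>I. (c * a j i)\<^sup>2) = l\<^sup>2 * (\<Sum>i\<in>I. (a j i)\<^sup>2)"
        by (simp add: power_mult_distrib that sum_distrib_left)
      also have "\<dots> \<le> l\<^sup>2 * s\<^sup>2" using a[OF j] by (intro mult_left_mono) auto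
      finally have "exp ((\<Sum>i\<in>I. (c * a j i)\<^sup>2) / 2) \<le> exp (l\<^sup>2 * s\<^sup>2 / 2)" by simp
      then show ?thesis using rademacher_avg_exp_le[OF I, of "\<lambda>i. c * a j i"] by linarith
    qed
    show "rademacher_avg I (\<lambda>\<epsilon>. exp (\<Sum>i\<in>I. \<epsilon> i * (l * a j i))) \<le> exp (l\<^sup>2 * s\<^sup>2 / 2)"
      "rademacher_avg I (\<lambda>\<epsilon>. exp (\<Sum>i\<in>I. \<epsilon> i * (- l * a j i))) \<le> exp (l\<^sup>2 * s\<^sup>2 / 2)"
      by (rule *; simp)+
  qed
  also have "\<dots> = 2 * N * exp (l\<^sup>2 * s\<^sup>2 / 2)" by (simp add: N_def)
  finally have "l * m \<le> ln (2 * N * exp (l\<^sup>2 * s\<^sup>2 / 2))" using N by (subst ln_ge_iff) auto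
  also have "\<dots> = ln (2 * N) + l\<^sup>2 * s\<^sup>2 / 2" using N by (subst ln_mult) auto
  also have "l\<^sup>2 * s\<^sup>2 = 2 * ln (2 * N)" using s lnpos by (simp add: l_def power_divide)
  also have "ln (2 * N) + 2 * ln (2 * N) / 2 = l * (s * sqrt (2 * ln (2 * N)))"
    using s lnpos by (simp add: l_def)
  finally have "m \<le> s * sqrt (2 * ln (2 * N))" using l by simp
  then show ?thesis unfolding m_def Y_def[abs_def] N_def .
qed

section \<open>Nets and the chaining bound for a fixed sample\<close>

text \<open>With \<open>D\<close> read as closeness, such a set is a packing and a net at once:
  separation feeds the cardinality bound, covering feeds the approximation in the chain.\<close>

lemma exists_maximal_separated:
  assumes "finite J" and "\<And>f. D f f" and "\<And>f g. D f g \<Longrightarrow> D g f"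
  shows "\<exists>T\<subseteq>J. (\<forall>f\<in>T. \<forall>g\<in>T. f \<noteq> g \<longrightarrow> \<not> D f g) \<and> (\<forall>f\<in>J. \<exists>g\<in>T. D f g)"
  using assms(1)
proof (induction J rule: finite_induct)
  case (insert h J)
  then obtain T where T: "T \<subseteq> J" "\<forall>f\<in>T. \<forall>g\<in>T. f \<noteq> g \<longrightarrow> \<not> D f g" "\<forall>f\<in>J. \<exists>g\<in>T. D f g" by blast
  show ?case
  proof (cases "\<exists>g\<in>T. D h g")
    case True
    then show ?thesis using T by (intro exI[of _ T]) auto
  next
    case False
    have "\<forall>f\<in>insert h T. \<forall>g\<in>insert h T. f \<noteq> g \<longrightarrow> \<not> D f g"
      using False T(2) assms(3) by (metis insert_iff)
    moreover have "\<forall>f\<in>insert h J. \<exists>g\<in>insert h T. D f g"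
      using T(3) assms(2) by (metis insert_iff)
    ultimately show ?thesis using T(1) by (intro exI[of _ "insert h T"]) auto
  qed
qed simp

lemma sum_inverse_power4: "(\<Sum>k\<le>K. 1 / 4 ^ k) = 4 / 3 - 1 / (3 * 4 ^ K :: real)"
proof (induction K)
  case (Suc K)
  show ?case unfolding sum.atMost_Suc Suc.IH by (simp add: divide_simps)
qed simp

lemma sum_linear_inverse_power4:
  "(\<Sum>k\<le>K. (real k + 1) / 4 ^ k) = 16 / 9 - (real K / 3 + 7 / 9) / (4 ^ K :: real)"
proof (induction K)
  case (Suc K)
  show ?case unfolding sum.atMost_Suc Suc.IH by (simp add: divide_simps)
qed simp

text \<open>The radicand is \<open>2 (ln 2 + 6 + 3/2 ln (1/e))\<close> at \<open>e = S / 16\<^sup>k\<^sup>+\<^sup>1\<close>, \<open>u = ln (1/S)\<close>, with \<open>ln 2\<close> replaced by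
  its upper bound \<open>25/36\<close>.\<close>

lemma dudley_sum_le:
  fixes u :: real
  assumes "u \<ge> 0"
  shows "(\<Sum>k\<le>K. sqrt (241 / 18 + 3 * u + 25 / 3 * (real k + 1)) / 4 ^ k) \<le> 2.37 * sqrt (9.11 + u)"
proof -
  define p where "p = 241 / 18 + 3 * u"
  \<comment> \<open>\<open>Y\<^sup>2\<close> is the mean of the radicands for the weights
    \<open>1 / 4 ^ k\<close> over all \<open>k\<close>: the weights sum to 4/3, the mean of
    \<open>k + 1\<close> is (16/9) / (4/3) = 4/3, and 241/18 + 25/3 * 4/3 = 49/2. The tangent of
    \<open>sqrt\<close> at this point gives the same bound as Jensen's inequality.\<close>
  define Y where "Y = sqrt (49 / 2 + 3 * u)"
  have Y: "Y > 0" "Y\<^sup>2 = 49 / 2 + 3 * u" using assms by (simp_all add: Y_def)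
  have p: "p \<ge> 0" using assms by (simp add: p_def)
  have "(\<Sum>k\<le>K. sqrt (p + 25 / 3 * (real k + 1)) / 4 ^ k)
      \<le> (\<Sum>k\<le>K. p / (2 * Y) * (1 / 4 ^ k) + 25 / (6 * Y) * ((real k + 1) / 4 ^ k) + Y / 2 * (1 / 4 ^ k))"
  proof (rule sum_mono)
    fix k
    define y where "y = p + 25 / 3 * (real k + 1)"
    have y: "y \<ge> 0" using p by (simp add: y_def)
    have "0 \<le> (sqrt y - Y)\<^sup>2" by simp
    then have "2 * Y * sqrt y \<le> y + Y\<^sup>2" using y by (simp add: power2_diff algebra_simps)
    then have "sqrt y \<le> (y + Y\<^sup>2) / (2 * Y)" using Y by (simp add: field_simps)
    also have "\<dots> = y / (2 * Y) + Y / 2" using Y(1) by (simp add: field_simps power2_eq_square)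
    finally have "sqrt y / 4 ^ k \<le> (y / (2 * Y) + Y / 2) / 4 ^ k" by (intro divide_right_mono) auto
    also have "\<dots> = p / (2 * Y) * (1 / 4 ^ k) + 25 / (6 * Y) * ((real k + 1) / 4 ^ k) + Y / 2 * (1 / 4 ^ k)"
      using Y by (simp add: y_def field_simps)
    finally show "sqrt (p + 25 / 3 * (real k + 1)) / 4 ^ k \<le> \<dots>" by (simp add: y_def)
  qed
  also have "\<dots> = p / (2 * Y) * (\<Sum>k\<le>K. 1 / 4 ^ k) + 25 / (6 * Y) * (\<Sum>k\<le>K. (real k + 1) / 4 ^ k) + Y / 2 * (\<Sum>k\<le>K. 1 / 4 ^ k)"
    by (simp only: sum.distrib sum_distrib_left)
  also have "\<dots> \<le> p / (2 * Y) * (4 / 3) + 25 / (6 * Y) * (16 / 9) + Y / 2 * (4 / 3)"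
  proof -
    have "(\<Sum>k\<le>K. 1 / 4 ^ k) \<le> (4 / 3 :: real)" "(\<Sum>k\<le>K. (real k + 1) / 4 ^ k) \<le> (16 / 9 :: real)"
      by (simp_all add: sum_inverse_power4 sum_linear_inverse_power4)
    then show ?thesis using Y p by (intro add_mono mult_left_mono) auto
  qed
  also have "\<dots> = 2 / 3 * (p + 100 / 9) / Y + 2 / 3 * Y" using Y by (simp add: field_simps)
  also have "p + 100 / 9 = Y\<^sup>2" by (simp add: p_def Y)
  also have "2 / 3 * Y\<^sup>2 / Y + 2 / 3 * Y = 4 / 3 * Y" using Y(1) by (simp add: power2_eq_square)
  also have "\<dots> = sqrt ((4 / 3 * Y)\<^sup>2)" using Y(1) by simp
  also have "sqrt ((4 / 3 * Y)\<^sup>2) = sqrt (16 / 9 * (49 / 2 + 3 * u))" unfolding power_mult_distrib Y(2) by (simp add: power_divide)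
  \<comment> \<open>Coefficientwise: 16/9 * 49/2 < 43.6 against 2.37^2 * 9.11 > 51, and 16/9 * 3 <
    5.4 against 2.37^2 > 5.6.\<close>
  also have "\<dots> \<le> sqrt (2.37\<^sup>2 * (9.11 + u))"
    using assms by (intro real_sqrt_le_mono) (simp add: power2_eq_square field_simps)
  also have "\<dots> = 2.37 * sqrt (9.11 + u)" by (simp add: real_sqrt_mult)
  finally show ?thesis by (simp add: p_def)
qed

lemma Max_abs_diff_le:
  fixes A :: "'j \<Rightarrow> real"
  assumes T: "finite T" "T \<noteq> {}" and T': "finite T'" and p: "\<And>f. f \<in> T \<Longrightarrow> p f \<in> T'"
  shows "Max ((\<lambda>f. \<bar>A f\<bar>) ` T) \<le> Max ((\<lambda>f. \<bar>A f\<bar>) ` T') + Max ((\<lambda>f. \<bar>A f - A (p f)\<bar>) ` T)"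
proof -
  have "\<bar>A f\<bar> \<le> Max ((\<lambda>f. \<bar>A f\<bar>) ` T') + Max ((\<lambda>f. \<bar>A f - A (p f)\<bar>) ` T)" if "f \<in> T" for f
  proof -
    have "\<bar>A (p f)\<bar> \<le> Max ((\<lambda>f. \<bar>A f\<bar>) ` T')" "\<bar>A f - A (p f)\<bar> \<le> Max ((\<lambda>f. \<bar>A f - A (p f)\<bar>) ` T)"
      using that T T' p by (auto intro!: Max_ge)
    then show ?thesis by linarith
  qed
  then show ?thesis using T by (intro Max.boundedI) auto
qed

text \<open>The nets use the empirical distance of the functions themselves, and the Lipschitz bound
  transfers increments to \<open>\<phi>\<close> of them at the price of \<open>l\<close>; the VC
  hypothesis on the class thus also serves its squares. Since \<open>\<phi> 0 = 0\<close>, the chain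
  can start at the zero vector, whose distance from every member is at most
  \<open>sqrt (n * S)\<close>.\<close>

lemma rademacher_avg_VC_subgraph_le:
  fixes x :: "'i \<Rightarrow> 'a" and \<phi> :: "real \<Rightarrow> real" and V l :: real
  assumes I: "finite I" "I \<noteq> {}" and x: "\<And>i. i \<in> I \<Longrightarrow> x i \<in> X"
    and J: "finite J" "J \<noteq> {}" and VC: "VC_subgraph_le X J V" and V: "1 \<le> V"
    and bnd: "\<And>f i. f \<in> J \<Longrightarrow> i \<in> I \<Longrightarrow> \<bar>f (x i)\<bar> \<le> 1"
    and \<phi>0: "\<phi> 0 = 0" and l: "l > 0"
    and lip: "\<And>a b. \<bar>a\<bar> \<le> 1 \<Longrightarrow> \<bar>b\<bar> \<le> 1 \<Longrightarrow> \<bar>\<phi> a - \<phi> b\<bar> \<le> l * \<bar>a - b\<bar>"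
  defines "S \<equiv> Max ((\<lambda>f. (\<Sum>i\<in>I. (f (x i))\<^sup>2) / real (card I)) ` J)"
  shows "rademacher_avg I (\<lambda>\<epsilon>. Max ((\<lambda>f. \<bar>\<Sum>i\<in>I. \<epsilon> i * \<phi> (f (x i))\<bar>) ` J))
      \<le> l * (2.37 * sqrt (real (card I) * V * (S * (9.11 + ln (1 / S)))))"
proof -
  define n where "n = real (card I)"
  have n: "n > 0" using I by (simp add: n_def card_gt_0_iff)
  define A where "A \<epsilon> f = (\<Sum>i\<in>I. \<epsilon> i * \<phi> (f (x i)))" for \<epsilon> and f :: "'a \<Rightarrow> real"
  define R where "R T = rademacher_avg I (\<lambda>\<epsilon>. Max ((\<lambda>f. \<bar>A \<epsilon> f\<bar>) ` T))" for T
  have fS: "(\<Sum>i\<in>I. (f (x i))\<^sup>2) \<le> n * S" if "f \<in> J" for f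
  proof -
    have "(\<Sum>i\<in>I. (f (x i))\<^sup>2) / n \<le> S" unfolding S_def n_def using J that by (intro Max_ge) auto
    then show ?thesis using n by (simp add: field_simps)
  qed
  have S0: "0 \<le> S"
  proof -
    obtain f where "f \<in> J" using J by auto
    then have "0 \<le> n * S" using fS[of f] sum_nonneg[of I "\<lambda>i. (f (x i))\<^sup>2"] by force
    then show ?thesis using n by (simp add: zero_le_mult_iff)
  qed
  have S1: "S \<le> 1"
    unfolding S_def
  proof (rule Max.boundedI)
    fix a assume "a \<in> (\<lambda>f. (\<Sum>i\<in>I. (f (x i))\<^sup>2) / real (card I)) ` J"
    then obtain f where f: "f \<in> J" "a = (\<Sum>i\<in>I. (f (x i))\<^sup>2) / real (card I)" by auto
    have "(\<Sum>i\<in>I. (f (x i))\<^sup>2) \<le> (\<Sum>i\<in>I. 1)" using bnd f(1) by (intro sum_mono) (auto simp: abs_square_le_1)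
    then show "a \<le> 1" using n by (simp add: f(2) n_def)
  qed (use J in auto)
  show ?thesis
  \<comment> \<open>For \<open>S = 0\<close> the radii degenerate, but then every function vanishes
    on the sample and all signed sums are zero.\<close>
  proof (cases "S = 0")
    case True
    have zero: "f (x i) = 0" if "f \<in> J" "i \<in> I" for f i
    proof -
      have "(f (x i))\<^sup>2 \<le> (\<Sum>i\<in>I. (f (x i))\<^sup>2)"
        using I that by (intro member_le_sum[of i I "\<lambda>i. (f (x i))\<^sup>2"]) auto
      also have "\<dots> \<le> n * 0" using fS[OF that(1)] by (simp only: True)
      finally show ?thesis by simp
    qed
    have "rademacher_avg I (\<lambda>\<epsilon>. Max ((\<lambda>f. \<bar>\<Sum>i\<in>I. \<epsilon> i * \<phi> (f (x i))\<bar>) ` J)) \<le> rademacher_avg I (\<lambda>\<epsilon>. 0)"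
    proof (rule rademacher_avg_mono, rule Max.boundedI)
      fix \<epsilon> a assume "a \<in> (\<lambda>f. \<bar>\<Sum>i\<in>I. \<epsilon> i * \<phi> (f (x i))\<bar>) ` J"
      then obtain f where f: "f \<in> J" "a = \<bar>\<Sum>i\<in>I. \<epsilon> i * \<phi> (f (x i))\<bar>" by blast
      have "(\<Sum>i\<in>I. \<epsilon> i * \<phi> (f (x i))) = (\<Sum>i\<in>I. 0)"
        by (intro sum.cong refl) (simp add: zero[OF f(1)] \<phi>0)
      then show "a \<le> 0" by (simp add: f(2))
    qed (use J in auto)
    then show ?thesis unfolding True using I by (simp add: rademacher_avg_const)
  next
    case False
    with S0 have S: "S > 0" by simp
    define u where "u = ln (1 / S)"
    have u: "u \<ge> 0" using S S1 by (simp add: u_def)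
    have incr: "rademacher_avg I (\<lambda>\<epsilon>. Max ((\<lambda>f. \<bar>\<Sum>i\<in>I. \<epsilon> i * a f i\<bar>) ` T)) \<le> l * sqrt (n * e) * sqrt (2 * ln (2 * real (card T)))"
      if T: "T \<subseteq> J" "T \<noteq> {}" and e: "e > 0" and a: "\<And>f. f \<in> T \<Longrightarrow> (\<Sum>i\<in>I. (a f i)\<^sup>2) \<le> l\<^sup>2 * (n * e)" for T a e
    proof (rule rademacher_avg_Max_le)
      show "finite T" using T J finite_subset by auto
    qed (use I T e l n a in \<open>auto simp: power_mult_distrib\<close>)
    \<comment> \<open>\<open>g\<close> is an arbitrary bounded vector over the index set: zero at
      the start of the chain, the values of a nearby net point in the links.\<close>
    have lip2: "(\<Sum>i\<in>I. (\<phi> (f (x i)) - \<phi> (g i))\<^sup>2) \<le> l\<^sup>2 * (\<Sum>i\<in>I. (f (x i) - g i)\<^sup>2)"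
      if f: "f \<in> J" and g: "\<And>i. i \<in> I \<Longrightarrow> \<bar>g i\<bar> \<le> 1" for f g
      unfolding sum_distrib_left
    proof (rule sum_mono)
      fix i assume i: "i \<in> I"
      have "\<bar>\<phi> (f (x i)) - \<phi> (g i)\<bar>\<^sup>2 \<le> (l * \<bar>f (x i) - g i\<bar>)\<^sup>2"
        using lip[OF bnd[OF f i] g[OF i]] by (intro power_mono) auto
      then show "(\<phi> (f (x i)) - \<phi> (g i))\<^sup>2 \<le> l\<^sup>2 * (f (x i) - g i)\<^sup>2" by (simp add: power_mult_distrib)
    qed
    have base: "R T \<le> l * sqrt (n * S) * sqrt (2 * ln (2 * real (card T)))" if T: "T \<subseteq> J" "T \<noteq> {}" for T
      unfolding R_def A_def
    proof (rule incr[OF T S])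
      fix f assume "f \<in> T"
      then have f: "f \<in> J" using T by auto
      have "(\<Sum>i\<in>I. (\<phi> (f (x i)))\<^sup>2) \<le> l\<^sup>2 * (\<Sum>i\<in>I. (f (x i))\<^sup>2)" using lip2[OF f, of "\<lambda>_. 0"] \<phi>0 by simp
      also have "\<dots> \<le> l\<^sup>2 * (n * S)" using fS[OF f] by (intro mult_left_mono) auto
      finally show "(\<Sum>i\<in>I. (\<phi> (f (x i)))\<^sup>2) \<le> l\<^sup>2 * (n * S)" .
    qed
    \<comment> \<open>Every \<open>f\<close> in \<open>T\<close> uses a single link, to a nearby
      \<open>p f\<close> in \<open>T'\<close>, so the maximum over increments involves only
      \<open>card T\<close> vectors.\<close>
    have step: "R T \<le> R T' + l * sqrt (n * e) * sqrt (2 * ln (2 * real (card T)))"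
      if T: "T \<subseteq> J" "T \<noteq> {}" and T': "T' \<subseteq> J" and e: "e > 0"
        and near: "\<forall>f\<in>J. \<exists>g\<in>T'. (\<Sum>i\<in>I. (f (x i) - g (x i))\<^sup>2) \<le> e * n" for T T' e
    proof -
      obtain p where p: "\<And>f. f \<in> J \<Longrightarrow> p f \<in> T' \<and> (\<Sum>i\<in>I. (f (x i) - p f (x i))\<^sup>2) \<le> e * n"
        using near by metis
      have fin: "finite T" "finite T'" using T T' J finite_subset by auto
      have "R T \<le> rademacher_avg I (\<lambda>\<epsilon>. Max ((\<lambda>f. \<bar>A \<epsilon> f\<bar>) ` T') + Max ((\<lambda>f. \<bar>A \<epsilon> f - A \<epsilon> (p f)\<bar>) ` T))"
        unfolding R_def using fin T p by (intro rademacher_avg_mono Max_abs_diff_le) auto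
      also have "\<dots> = R T' + rademacher_avg I (\<lambda>\<epsilon>. Max ((\<lambda>f. \<bar>\<Sum>i\<in>I. \<epsilon> i * (\<phi> (f (x i)) - \<phi> (p f (x i)))\<bar>) ` T))"
        by (simp add: rademacher_avg_add R_def A_def sum_subtractf algebra_simps)
      also have "rademacher_avg I (\<lambda>\<epsilon>. Max ((\<lambda>f. \<bar>\<Sum>i\<in>I. \<epsilon> i * (\<phi> (f (x i)) - \<phi> (p f (x i)))\<bar>) ` T))
          \<le> l * sqrt (n * e) * sqrt (2 * ln (2 * real (card T)))"
      proof (rule incr[OF T e])
        fix f assume "f \<in> T"
        then have f: "f \<in> J" using T by auto
        have "(\<Sum>i\<in>I. (\<phi> (f (x i)) - \<phi> (p f (x i)))\<^sup>2) \<le> l\<^sup>2 * (\<Sum>i\<in>I. (f (x i) - p f (x i))\<^sup>2)"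
          using p[OF f] T' bnd by (intro lip2[OF f]) auto
        also have "\<dots> \<le> l\<^sup>2 * (e * n)" using p[OF f] by (intro mult_left_mono) auto
        finally show "(\<Sum>i\<in>I. (\<phi> (f (x i)) - \<phi> (p f (x i)))\<^sup>2) \<le> l\<^sup>2 * (n * e)" by (simp add: mult.commute)
      qed
      finally show ?thesis by simp
    qed
    define D where "D e f g \<longleftrightarrow> (\<Sum>i\<in>I. (f (x i) - g (x i))\<^sup>2) \<le> e * n" for e and f g :: "'a \<Rightarrow> real"
    have "\<exists>T\<subseteq>J. (\<forall>f\<in>T. \<forall>g\<in>T. f \<noteq> g \<longrightarrow> \<not> D e f g) \<and> (\<forall>f\<in>J. \<exists>g\<in>T. D e f g)" if "e > 0" for e
    proof (rule exists_maximal_separated[OF J(1)])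
      show "D e f f" for f using that n by (simp add: D_def)
      show "D e g f" if "D e f g" for f g using that by (simp add: D_def power2_commute)
    qed
    then obtain net where net0: "\<And>e. e > 0 \<Longrightarrow> net e \<subseteq> J \<and> (\<forall>f\<in>net e. \<forall>g\<in>net e. f \<noteq> g \<longrightarrow> \<not> D e f g)
        \<and> (\<forall>f\<in>J. \<exists>g\<in>net e. D e f g)"
      by metis
    have net: "net e \<subseteq> J"
      "\<And>f g. f \<in> net e \<Longrightarrow> g \<in> net e \<Longrightarrow> f \<noteq> g \<Longrightarrow> e * n < (\<Sum>i\<in>I. (f (x i) - g (x i))\<^sup>2)"
      "\<forall>f\<in>J. \<exists>g\<in>net e. (\<Sum>i\<in>I. (f (x i) - g (x i))\<^sup>2) \<le> e * n" if "e > 0" for e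
      using net0[OF that] unfolding D_def not_le by blast+
    define e where "e k = S / 16 ^ k" for k :: nat
    have e: "e k > 0" "e k \<le> 1" for k
    proof -
      have "1 * S \<le> 16 ^ k * 1" using S S1 by (intro mult_mono) auto
      then show "e k > 0" "e k \<le> 1" using S by (simp_all add: e_def)
    qed
    define T where "T k = net (e k)" for k
    have T: "T k \<subseteq> J" "T k \<noteq> {}" for k
      unfolding T_def using net(1)[OF e(1)] net(3)[OF e(1)] J(2) by fast+
    have cardT: "sqrt (2 * ln (2 * real (card (T k)))) \<le> sqrt V * sqrt (241 / 18 + 3 * u + 25 / 3 * real k)" for k
    proof -
      have finT: "finite (T k)" using finite_subset[OF T(1) J(1)] .
      then have c: "card (T k) > 0" using T(2) by (simp add: card_gt_0_iff)
      have "ln (real (card (T k))) \<le> V * (6 + 3 / 2 * ln (1 / e k))"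
      proof (rule ln_packing_le[OF I(1) x finT])
        show "VC_subgraph_le X (T k) V" using VC T(1) by (rule VC_subgraph_le_subset)
        show "e k * real (card I) < (\<Sum>i\<in>I. (f (x i) - g (x i))\<^sup>2)" if "f \<in> T k" "g \<in> T k" "f \<noteq> g" for f g
          using net(2)[OF e(1)] that unfolding T_def n_def by blast
        show "\<bar>f (x i)\<bar> \<le> 1" if "f \<in> T k" "i \<in> I" for f i using that T(1) bnd by blast
      qed (use V e in simp_all)
      moreover have "ln (1 / e k) \<le> u + real k * (25 / 9)"
      proof -
        have "ln (1 / e k) = u + real k * ln (2 ^ 4)" using S by (simp add: e_def u_def ln_div ln_realpow)
        also have "ln ((2::real) ^ 4) = 4 * ln 2" by (subst ln_realpow) auto
        also have "real k * (4 * ln 2) \<le> real k * (25 / 9)" using ln2_le_25_over_36 by (intro mult_left_mono) auto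
        finally show ?thesis by simp
      qed
      then have "V * (6 + 3 / 2 * ln (1 / e k)) \<le> V * (6 + 3 / 2 * (u + real k * (25 / 9)))"
        using V by (intro mult_left_mono) auto
      moreover have "ln 2 \<le> V * (25 / 36)" using V ln2_le_25_over_36 by simp
      moreover have "ln (2 * real (card (T k))) = ln 2 + ln (real (card (T k)))" using c by (simp add: ln_mult)
      ultimately have "2 * ln (2 * real (card (T k))) \<le> V * (241 / 18 + 3 * u + 25 / 3 * real k)"
        by (simp add: algebra_simps)
      then show ?thesis unfolding real_sqrt_mult[symmetric] by (rule real_sqrt_le_mono)
    qed
    have sqe: "sqrt (n * e k) = sqrt (n * S) / 4 ^ k" for k
    proof -
      have "(16::real) ^ k = (4 ^ k)\<^sup>2" by (simp add: power2_eq_square power_mult_distrib[symmetric])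
      then show ?thesis by (simp add: e_def real_sqrt_divide)
    qed
    \<comment> \<open>Term \<open>k\<close> pairs the radius \<open>sqrt (n * S) / 4 ^ k\<close>
      with the size of the next finer net \<open>T (Suc k)\<close>; this shift is the
      \<open>k + 1\<close> in the radicand. The chain begins with \<open>T 1\<close> because zero
      acts as the coarsest net.\<close>
    have chain: "R (T (Suc K)) \<le> l * sqrt (n * S) * sqrt V * (\<Sum>k\<le>K. sqrt (241 / 18 + 3 * u + 25 / 3 * (real k + 1)) / 4 ^ k)" for K
    proof (induction K)
      case 0
      have "R (T (Suc 0)) \<le> l * sqrt (n * S) * sqrt (2 * ln (2 * real (card (T (Suc 0)))))" by (rule base[OF T])
      also have "\<dots> \<le> l * sqrt (n * S) * (sqrt V * sqrt (241 / 18 + 3 * u + 25 / 3 * real (Suc 0)))"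
        using l n S by (intro mult_left_mono cardT) auto
      finally show ?case by simp
    next
      case (Suc K)
      have "R (T (Suc (Suc K))) \<le> R (T (Suc K)) + l * sqrt (n * e (Suc K)) * sqrt (2 * ln (2 * real (card (T (Suc (Suc K))))))"
        unfolding T_def[of "Suc K"] by (rule step[OF T net(1)[OF e(1)] e(1) net(3)[OF e(1)]])
      also have "l * sqrt (n * e (Suc K)) * sqrt (2 * ln (2 * real (card (T (Suc (Suc K))))))
          \<le> l * sqrt (n * e (Suc K)) * (sqrt V * sqrt (241 / 18 + 3 * u + 25 / 3 * real (Suc (Suc K))))"
        using l n e(1)[of "Suc K"] by (intro mult_left_mono cardT) auto
      also have "\<dots> = l * sqrt (n * S) * sqrt V * (sqrt (241 / 18 + 3 * u + 25 / 3 * (real (Suc K) + 1)) / 4 ^ Suc K)"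
        by (simp add: sqe add.commute)
      finally have "R (T (Suc (Suc K))) \<le> R (T (Suc K)) +
          l * sqrt (n * S) * sqrt V * (sqrt (241 / 18 + 3 * u + 25 / 3 * (real (Suc K) + 1)) / 4 ^ Suc K)"
        by simp
      with Suc.IH show ?case
        unfolding sum.atMost_Suc distrib_left[of "l * sqrt (n * S) * sqrt V"] by linarith
    qed
    define B where "B = l * sqrt (n * S) * sqrt V * (2.37 * sqrt (9.11 + u))"
    \<comment> \<open>The last link leads from all of \<open>J\<close> to a net. Its factor
      depending on \<open>card J\<close> is fixed while the radius tends to zero, so the limit bound
      is independent of the size of \<open>J\<close>.\<close>
    have "R J \<le> B + l * sqrt (n * S) * sqrt (2 * ln (2 * real (card J))) * (1 / 4) ^ Suc K" for K
    proof -
      have "R J \<le> R (T (Suc K)) + l * sqrt (n * e (Suc K)) * sqrt (2 * ln (2 * real (card J)))"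
        unfolding T_def by (rule step[OF subset_refl J(2) net(1)[OF e(1)] e(1) net(3)[OF e(1)]])
      moreover have "R (T (Suc K)) \<le> B"
        unfolding B_def by (rule order_trans[OF chain mult_left_mono[OF dudley_sum_le[OF u]]]) (use l n S V in simp)
      moreover have "l * sqrt (n * e (Suc K)) * sqrt (2 * ln (2 * real (card J)))
          = l * sqrt (n * S) * sqrt (2 * ln (2 * real (card J))) * (1 / 4) ^ Suc K"
        unfolding sqe by (simp add: power_one_over)
      ultimately show ?thesis by linarith
    qed
    moreover have "(\<lambda>K. B + l * sqrt (n * S) * sqrt (2 * ln (2 * real (card J))) * (1 / 4) ^ Suc K)
        \<longlonglongrightarrow> B + l * sqrt (n * S) * sqrt (2 * ln (2 * real (card J))) * 0"
      by (intro tendsto_intros LIMSEQ_Suc LIMSEQ_power_zero) auto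
    ultimately have "R J \<le> B + l * sqrt (n * S) * sqrt (2 * ln (2 * real (card J))) * 0"
      by (intro LIMSEQ_le_const) auto
    then have "R J \<le> B" by simp
    also have "B = l * (2.37 * sqrt (n * V * (S * (9.11 + u))))"
      unfolding B_def by (simp only: real_sqrt_mult mult_ac)
    finally show ?thesis unfolding R_def A_def n_def u_def .
  qed
qed

subsection \<open>Symmetrization\<close>

lemma rademacher_avg_insert:
  assumes "finite I" "k \<notin> I"
  shows "rademacher_avg (insert k I) H =
    (rademacher_avg I (\<lambda>\<epsilon>. H (\<epsilon>(k := 1))) + rademacher_avg I (\<lambda>\<epsilon>. H (\<epsilon>(k := -1)))) / 2"
proof -
  let ?P = "PiE I (\<lambda>_. {-1, 1::real})"
  have "(\<Sum>\<epsilon>\<in>PiE (insert k I) (\<lambda>_. {-1, 1}). H \<epsilon>) = (\<Sum>(y, g)\<in>{-1, 1} \<times> ?P. H (g(k := y)))"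
    unfolding PiE_insert_eq
    by (subst sum.reindex[OF inj_combinator[OF assms(2)]]) (simp add: case_prod_unfold)
  also have "\<dots> = (\<Sum>y\<in>{-1, 1}. \<Sum>g\<in>?P. H (g(k := y)))" by (rule sum.cartesian_product[symmetric])
  finally show ?thesis using assms by (simp add: rademacher_avg_def add_divide_distrib)
qed

lemma ennreal_average: "0 \<le> a \<Longrightarrow> 0 \<le> b \<Longrightarrow> ennreal ((a + b) / 2) = ennreal (1 / 2) * (ennreal a + ennreal b)"
  using ennreal_mult[of "1 / 2" "a + b"] ennreal_plus[of a b] by (metis add_nonneg_nonneg divide_nonneg_nonneg
    mult.commute times_divide_eq_right mult_1_right zero_le_numeral zero_le_one)

lemma Max_abs_nonneg:
  fixes A :: "'j \<Rightarrow> real"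
  assumes "finite J" "J \<noteq> {}"
  shows "0 \<le> Max ((\<lambda>j. \<bar>A j\<bar>) ` J)"
proof -
  obtain j where "j \<in> J" using assms by auto
  then have "\<bar>A j\<bar> \<le> Max ((\<lambda>j. \<bar>A j\<bar>) ` J)" using assms by (intro Max_ge) auto
  then show ?thesis using abs_ge_zero[of "A j"] by linarith
qed

lemma rademacher_avg_nonneg: "(\<And>\<epsilon>. 0 \<le> h \<epsilon>) \<Longrightarrow> 0 \<le> rademacher_avg I h"
  unfolding rademacher_avg_def by (intro divide_nonneg_nonneg sum_nonneg) auto

text \<open>Since \<open>h Y - E h = E' (h Y - h Y')\<close> and \<open>c + h Y - h Y'\<close> is the midpoint of \<open>c + 2 h Y\<close> and
  \<open>c - 2 h Y'\<close>, convexity alone symmetrizes a single coordinate.\<close>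

lemma (in prob_space) symmetrization_single:
  fixes h :: "'j \<Rightarrow> 'a \<Rightarrow> real" and c :: "'j \<Rightarrow> real"
  assumes J: "finite J" "J \<noteq> {}" and h: "\<And>j. j \<in> J \<Longrightarrow> integrable M (h j)"
  shows "(\<integral>\<^sup>+ y. ennreal (Max ((\<lambda>j. \<bar>c j + (h j y - expectation (h j))\<bar>) ` J)) \<partial>M)
    \<le> (\<integral>\<^sup>+ y. ennreal ((Max ((\<lambda>j. \<bar>c j + 2 * h j y\<bar>) ` J) + Max ((\<lambda>j. \<bar>c j - 2 * h j y\<bar>) ` J)) / 2) \<partial>M)"
proof -
  define G where "G v = Max ((\<lambda>j. \<bar>v j\<bar>) ` J)" for v :: "'j \<Rightarrow> real"
  have G0: "0 \<le> G v" for v unfolding G_def by (rule Max_abs_nonneg[OF J])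
  have Gge: "\<bar>v j\<bar> \<le> G v" if "j \<in> J" for v j unfolding G_def using that J by (intro Max_ge) auto
  have hm[measurable]: "h j \<in> borel_measurable M" if "j \<in> J" for j using h[OF that] by auto
  have m1[measurable]: "(\<lambda>y. G (\<lambda>j. c j + 2 * h j y)) \<in> borel_measurable M"
    and m2[measurable]: "(\<lambda>y. G (\<lambda>j. c j - 2 * h j y)) \<in> borel_measurable M"
    unfolding G_def using J(1) by (auto intro!: borel_measurable_Max)
  have "(\<integral>\<^sup>+ y. ennreal (G (\<lambda>j. c j + (h j y - expectation (h j)))) \<partial>M)
      \<le> (\<integral>\<^sup>+ y. \<integral>\<^sup>+ y'. ennreal (G (\<lambda>j. c j + (h j y - h j y'))) \<partial>M \<partial>M)"
  proof (rule nn_integral_mono)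
    fix y
    \<comment> \<open>For fixed \<open>y\<close> the maximum is attained at one index, so the
      inequality between the absolute value of a mean and the mean of the absolute value is needed
      for one function only.\<close>
    have "G (\<lambda>j. c j + (h j y - expectation (h j))) \<in> (\<lambda>j. \<bar>c j + (h j y - expectation (h j))\<bar>) ` J"
      unfolding G_def using J by (intro Max_in) auto
    then obtain j where j: "j \<in> J" "G (\<lambda>j. c j + (h j y - expectation (h j))) = \<bar>c j + (h j y - expectation (h j))\<bar>" by blast
    have int: "integrable M (\<lambda>y'. c j + (h j y - h j y'))" using h[OF j(1)] by auto
    have "c j + (h j y - expectation (h j)) = expectation (\<lambda>y'. c j + (h j y - h j y'))"
      using h[OF j(1)] by (simp add: prob_space)
    then have "ennreal (G (\<lambda>j. c j + (h j y - expectation (h j)))) \<le> ennreal (expectation (\<lambda>y'. \<bar>c j + (h j y - h j y')\<bar>))"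
      unfolding j(2) by (intro ennreal_leI) (metis integral_abs_bound)
    also have "\<dots> = (\<integral>\<^sup>+ y'. ennreal \<bar>c j + (h j y - h j y')\<bar> \<partial>M)"
      using int by (intro nn_integral_eq_integral[symmetric]) auto
    also have "\<dots> \<le> (\<integral>\<^sup>+ y'. ennreal (G (\<lambda>j. c j + (h j y - h j y'))) \<partial>M)"
    proof (intro nn_integral_mono ennreal_leI)
      show "\<bar>c j + (h j y - h j y')\<bar> \<le> G (\<lambda>j. c j + (h j y - h j y'))" for y'
        using Gge[OF j(1), of "\<lambda>j. c j + (h j y - h j y')"] .
    qed
    finally show "ennreal (G (\<lambda>j. c j + (h j y - expectation (h j)))) \<le> \<dots>" .
  qed
  also have "\<dots> \<le> (\<integral>\<^sup>+ y. \<integral>\<^sup>+ y'. ennreal (1/2) * (ennreal (G (\<lambda>j. c j + 2 * h j y)) + ennreal (G (\<lambda>j. c j - 2 * h j y'))) \<partial>M \<partial>M)"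
  proof (intro nn_integral_mono)
    fix y y'
    have "G (\<lambda>j. c j + (h j y - h j y')) \<le> (G (\<lambda>j. c j + 2 * h j y) + G (\<lambda>j. c j - 2 * h j y')) / 2"
      unfolding G_def[of "\<lambda>j. c j + (h j y - h j y')"]
    proof (rule Max.boundedI)
      fix a assume "a \<in> (\<lambda>j. \<bar>c j + (h j y - h j y')\<bar>) ` J"
      then obtain j where j: "j \<in> J" "a = \<bar>c j + (h j y - h j y')\<bar>" by blast
      have mid: "\<bar>a + (b - b')\<bar> \<le> (p + q) / 2" if "\<bar>a + 2 * b\<bar> \<le> p" "\<bar>a - 2 * b'\<bar> \<le> q" for a b b' p q :: real
      proof -
        have "a + (b - b') = ((a + 2 * b) + (a - 2 * b')) / 2" by (simp add: field_simps)
        then have "\<bar>a + (b - b')\<bar> = \<bar>(a + 2 * b) + (a - 2 * b')\<bar> / 2"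
          by (simp only: abs_divide abs_numeral)
        also have "\<dots> \<le> (\<bar>a + 2 * b\<bar> + \<bar>a - 2 * b'\<bar>) / 2" by (intro divide_right_mono abs_triangle_ineq) simp
        also have "\<dots> \<le> (p + q) / 2" using that by (intro divide_right_mono add_mono) auto
        finally show ?thesis .
      qed
      show "a \<le> (G (\<lambda>j. c j + 2 * h j y) + G (\<lambda>j. c j - 2 * h j y')) / 2"
        unfolding j(2) by (rule mid) (fact Gge[OF j(1), of "\<lambda>j. c j + 2 * h j y"] Gge[OF j(1), of "\<lambda>j. c j - 2 * h j y'"])+
    qed (use J in auto)
    then show "ennreal (G (\<lambda>j. c j + (h j y - h j y'))) \<le> ennreal (1/2) * (ennreal (G (\<lambda>j. c j + 2 * h j y)) + ennreal (G (\<lambda>j. c j - 2 * h j y')))"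
      by (subst ennreal_average[symmetric]) (auto intro: ennreal_leI G0)
  qed
  \<comment> \<open>The two variables now stand in separate summands. Integrating out the absent one
    gives a factor 1, and the independent copy disappears.\<close>
  also have "\<dots> = ennreal (1/2) * ((\<integral>\<^sup>+ y. ennreal (G (\<lambda>j. c j + 2 * h j y)) \<partial>M) + (\<integral>\<^sup>+ y. ennreal (G (\<lambda>j. c j - 2 * h j y)) \<partial>M))"
    by (simp add: nn_integral_cmult nn_integral_add emeasure_space_1)
  also have "\<dots> = (\<integral>\<^sup>+ y. ennreal ((G (\<lambda>j. c j + 2 * h j y) + G (\<lambda>j. c j - 2 * h j y)) / 2) \<partial>M)"
    by (simp only: ennreal_average[OF G0 G0]) (simp add: nn_integral_cmult nn_integral_add)
  finally show ?thesis unfolding G_def .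
qed

text \<open>The free shift \<open>c\<close> is what makes induction over the coordinates possible:
  it absorbs plus or minus \<open>2 * h j y\<close> from a coordinate that has just been
  symmetrized.\<close>

lemma symmetrization:
  fixes N :: "'i \<Rightarrow> 'a measure" and h :: "'j \<Rightarrow> 'a \<Rightarrow> real" and c :: "'j \<Rightarrow> real"
  assumes N: "\<And>i. prob_space (N i)" and I: "finite I" and J: "finite J" "J \<noteq> {}"
    and h: "\<And>i j. j \<in> J \<Longrightarrow> integrable (N i) (h j)"
  shows "(\<integral>\<^sup>+ x. ennreal (Max ((\<lambda>j. \<bar>c j + (\<Sum>i\<in>I. h j (x i) - integral\<^sup>L (N i) (h j))\<bar>) ` J)) \<partial>PiM I N)
    \<le> (\<integral>\<^sup>+ x. ennreal (rademacher_avg I (\<lambda>\<epsilon>. Max ((\<lambda>j. \<bar>c j + 2 * (\<Sum>i\<in>I. \<epsilon> i * h j (x i))\<bar>) ` J))) \<partial>PiM I N)"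
  using I
proof (induction I arbitrary: c rule: finite_induct)
  case empty
  show ?case by (simp add: rademacher_avg_def)
next
  case (insert k I)
  interpret product_sigma_finite N
    using N by (simp add: product_sigma_finite_def prob_space_imp_sigma_finite)
  interpret k: prob_space "N k" by (rule N)
  define G where "G v = Max ((\<lambda>j. \<bar>v j\<bar>) ` J)" for v :: "'j \<Rightarrow> real"
  have G0: "0 \<le> G v" for v unfolding G_def by (rule Max_abs_nonneg[OF J])
  have hm[measurable]: "h j \<in> borel_measurable (N i)" if "j \<in> J" for i j using h[OF that] by auto
  have Gm: "(\<lambda>x. G (\<lambda>j. v j x)) \<in> borel_measurable M" if "\<And>j. j \<in> J \<Longrightarrow> v j \<in> borel_measurable M" for M :: "'z measure" and v
    unfolding G_def using J(1) that by (auto intro!: borel_measurable_Max)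
  have hc: "(\<lambda>x. h j (x i)) \<in> borel_measurable (PiM A N)" if "j \<in> J" "i \<in> A" for i j A
    using measurable_compose[OF measurable_component_singleton[OF that(2)] hm[OF that(1)]] .
  define m where "m i j = integral\<^sup>L (N i) (h j)" for i j
  define Q where "Q x j = (\<Sum>i\<in>I. h j (x i) - m i j)" for x :: "'i \<Rightarrow> 'a" and j
  define R where "R c x = rademacher_avg I (\<lambda>\<epsilon>. G (\<lambda>j. c j + 2 * (\<Sum>i\<in>I. \<epsilon> i * h j (x i))))" for c and x :: "'i \<Rightarrow> 'a"
  have R0: "0 \<le> R c x" for c x unfolding R_def by (intro rademacher_avg_nonneg G0)
  have IH: "(\<integral>\<^sup>+ x. ennreal (G (\<lambda>j. c j + Q x j)) \<partial>PiM I N) \<le> (\<integral>\<^sup>+ x. ennreal (R c x) \<partial>PiM I N)" for c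
    using insert.IH[of c] unfolding G_def R_def Q_def m_def .
  have sum_upd: "(\<Sum>i\<in>insert k I. (\<epsilon>(k := s)) i * h j ((x(k := y)) i)) = s * h j y + (\<Sum>i\<in>I. \<epsilon> i * h j (x i))" for s \<epsilon> j x y
  proof -
    have "(\<Sum>i\<in>I. (\<epsilon>(k := s)) i * h j ((x(k := y)) i)) = (\<Sum>i\<in>I. \<epsilon> i * h j (x i))"
      using insert.hyps(2) by (intro sum.cong) auto
    then show ?thesis using insert.hyps by simp
  qed
  have Q_upd: "(\<Sum>i\<in>insert k I. h j ((x(k := y)) i) - m i j) = Q x j + (h j y - m k j)" for j x y
  proof -
    have "(\<Sum>i\<in>I. h j ((x(k := y)) i) - m i j) = Q x j"
      unfolding Q_def using insert.hyps(2) by (intro sum.cong) auto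
    then show ?thesis using insert.hyps by simp
  qed
  \<comment> \<open>Averaging over the sign at \<open>k\<close> reproduces exactly the two shifts
    that come out of the single-coordinate estimate.\<close>
  have RI: "rademacher_avg (insert k I) (\<lambda>\<epsilon>. G (\<lambda>j. c j + 2 * (\<Sum>i\<in>insert k I. \<epsilon> i * h j ((x(k := y)) i))))
      = (R (\<lambda>j. c j + 2 * h j y) x + R (\<lambda>j. c j - 2 * h j y) x) / 2" for x y
    unfolding rademacher_avg_insert[OF insert.hyps] R_def sum_upd by (simp add: algebra_simps)
  have "(\<integral>\<^sup>+ x. ennreal (G (\<lambda>j. c j + (\<Sum>i\<in>insert k I. h j (x i) - m i j))) \<partial>PiM (insert k I) N)
      = (\<integral>\<^sup>+ x. \<integral>\<^sup>+ y. ennreal (G (\<lambda>j. c j + (\<Sum>i\<in>insert k I. h j ((x(k := y)) i) - m i j))) \<partial>N k \<partial>PiM I N)"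
    using insert.hyps
    by (intro product_nn_integral_insert measurable_compose[OF Gm measurable_ennreal] borel_measurable_add
        borel_measurable_const borel_measurable_sum borel_measurable_diff hc) auto
  also have "\<dots> = (\<integral>\<^sup>+ x. \<integral>\<^sup>+ y. ennreal (G (\<lambda>j. (c j + Q x j) + (h j y - m k j))) \<partial>N k \<partial>PiM I N)"
    unfolding Q_upd by (simp only: add.assoc)
  also have "\<dots> \<le> (\<integral>\<^sup>+ x. \<integral>\<^sup>+ y. ennreal ((G (\<lambda>j. (c j + Q x j) + 2 * h j y) + G (\<lambda>j. (c j + Q x j) - 2 * h j y)) / 2) \<partial>N k \<partial>PiM I N)"
    unfolding G_def m_def by (intro nn_integral_mono k.symmetrization_single J h)
  \<comment> \<open>The single-coordinate estimate needs \<open>y\<close> as the inner variable, the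
    induction hypothesis needs the rest of the sample there; hence the exchange.\<close>
  also have "\<dots> = (\<integral>\<^sup>+ y. \<integral>\<^sup>+ x. ennreal ((G (\<lambda>j. (c j + Q x j) + 2 * h j y) + G (\<lambda>j. (c j + Q x j) - 2 * h j y)) / 2) \<partial>PiM I N \<partial>N k)"
  proof (rule pair_sigma_finite.Fubini')
    show "pair_sigma_finite (N k) (PiM I N)"
      using sigma_finite[OF insert.hyps(1)] sigma_finite_measures by (simp add: pair_sigma_finite.intro)
    have [measurable]: "(\<lambda>z. h j (fst z)) \<in> borel_measurable (N k \<Otimes>\<^sub>M PiM I N)" if "j \<in> J" for j
      using that by measurable
    have [measurable]: "(\<lambda>z. Q (snd z) j) \<in> borel_measurable (N k \<Otimes>\<^sub>M PiM I N)" if "j \<in> J" for j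
      unfolding Q_def using that
      by (intro borel_measurable_sum borel_measurable_diff borel_measurable_const measurable_compose[OF measurable_snd hc])
    show "(\<lambda>(y, x). ennreal ((G (\<lambda>j. (c j + Q x j) + 2 * h j y) + G (\<lambda>j. (c j + Q x j) - 2 * h j y)) / 2))
        \<in> borel_measurable (N k \<Otimes>\<^sub>M PiM I N)"
      unfolding case_prod_unfold
      by (intro measurable_compose[OF _ measurable_ennreal] borel_measurable_divide borel_measurable_add Gm
          borel_measurable_const) measurable
  qed
  also have "\<dots> \<le> (\<integral>\<^sup>+ y. \<integral>\<^sup>+ x. ennreal ((R (\<lambda>j. c j + 2 * h j y) x + R (\<lambda>j. c j - 2 * h j y) x) / 2) \<partial>PiM I N \<partial>N k)"
  proof (rule nn_integral_mono)
    fix y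
    have GQ: "(\<lambda>x. ennreal (G (\<lambda>j. v j + Q x j))) \<in> borel_measurable (PiM I N)" for v
      unfolding Q_def
      by (intro measurable_compose[OF Gm measurable_ennreal] borel_measurable_add
        borel_measurable_const borel_measurable_sum borel_measurable_diff hc)
    have Rm: "(\<lambda>x. ennreal (R v x)) \<in> borel_measurable (PiM I N)" for v
      unfolding R_def rademacher_avg_def
      by (intro measurable_compose[OF _ measurable_ennreal] borel_measurable_divide Gm borel_measurable_add
        borel_measurable_const borel_measurable_sum borel_measurable_times hc)
    have "(\<integral>\<^sup>+ x. ennreal ((G (\<lambda>j. (c j + Q x j) + 2 * h j y) + G (\<lambda>j. (c j + Q x j) - 2 * h j y)) / 2) \<partial>PiM I N)
        = ennreal (1/2) * ((\<integral>\<^sup>+ x. ennreal (G (\<lambda>j. (c j + 2 * h j y) + Q x j)) \<partial>PiM I N) + (\<integral>\<^sup>+ x. ennreal (G (\<lambda>j. (c j - 2 * h j y) + Q x j)) \<partial>PiM I N))"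
    proof -
      have eq: "(\<lambda>j. (c j + Q x j) + 2 * h j y) = (\<lambda>j. (c j + 2 * h j y) + Q x j)"
        "(\<lambda>j. (c j + Q x j) - 2 * h j y) = (\<lambda>j. (c j - 2 * h j y) + Q x j)" for x by auto
      show ?thesis
        unfolding eq ennreal_average[OF G0 G0] by (simp only: nn_integral_cmult nn_integral_add GQ borel_measurable_add)
    qed
    also have "\<dots> \<le> ennreal (1/2) * ((\<integral>\<^sup>+ x. ennreal (R (\<lambda>j. c j + 2 * h j y) x) \<partial>PiM I N) + (\<integral>\<^sup>+ x. ennreal (R (\<lambda>j. c j - 2 * h j y) x) \<partial>PiM I N))"
      by (intro mult_left_mono add_mono IH) auto
    also have "\<dots> = (\<integral>\<^sup>+ x. ennreal ((R (\<lambda>j. c j + 2 * h j y) x + R (\<lambda>j. c j - 2 * h j y) x) / 2) \<partial>PiM I N)"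
      using Rm by (simp only: ennreal_average[OF R0 R0]) (simp add: nn_integral_cmult nn_integral_add)
    finally show "(\<integral>\<^sup>+ x. ennreal ((G (\<lambda>j. (c j + Q x j) + 2 * h j y) + G (\<lambda>j. (c j + Q x j) - 2 * h j y)) / 2) \<partial>PiM I N) \<le> \<dots>" .
  qed
  also have "\<dots> = (\<integral>\<^sup>+ x. ennreal (rademacher_avg (insert k I) (\<lambda>\<epsilon>. G (\<lambda>j. c j + 2 * (\<Sum>i\<in>insert k I. \<epsilon> i * h j (x i))))) \<partial>PiM (insert k I) N)"
  proof (subst product_nn_integral_insert_rev[OF insert.hyps])
    show "(\<lambda>x. ennreal (rademacher_avg (insert k I) (\<lambda>\<epsilon>. G (\<lambda>j. c j + 2 * (\<Sum>i\<in>insert k I. \<epsilon> i * h j (x i))))))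
        \<in> borel_measurable (PiM (insert k I) N)"
      unfolding rademacher_avg_def
      by (intro measurable_compose[OF _ measurable_ennreal] borel_measurable_divide Gm borel_measurable_add
        borel_measurable_const borel_measurable_sum borel_measurable_times hc)
  qed (simp only: RI)
  finally show ?case unfolding G_def m_def .
qed

subsection \<open>Bound on the expected supremum\<close>

text \<open>This is concavity: the right-hand side is the tangent at \<open>s\<close> of the
  function of \<open>y\<close> on the left, and differentiation lowers 9.11 to 8.11. The analytic
  input is \<open>ln t \<le> t - 1\<close> at \<open>t = s / y\<close>.\<close>

lemma mult_ln_inverse_tangent_le:
  fixes y s :: real
  assumes "0 \<le> y" "0 < s"
  shows "y * (9.11 + ln (1 / y)) \<le> y * (8.11 + ln (1 / s)) + s"
proof (cases "y = 0")
  case False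
  then have y: "y > 0" using assms by simp
  have "ln (s / y) \<le> s / y - 1" using y assms by (intro ln_le_minus_one) auto
  then have "y * ln (s / y) \<le> y * (s / y - 1)" using y by (intro mult_left_mono) auto
  then have "y * ln (1 / y) - y * ln (1 / s) \<le> s - y"
    using y assms by (simp add: ln_div right_diff_distrib)
  then show ?thesis by (simp add: distrib_left)
qed (use assms in simp)

text \<open>If \<open>b\<close> exceeded \<open>A + B\<close>, then b^2 > (A + B) b \<ge> A^2 + B
  b.\<close>

lemma le_add_of_square_le:
  fixes b A B :: real
  assumes "0 \<le> A" "0 \<le> B" "b\<^sup>2 \<le> A\<^sup>2 + B * b"
  shows "b \<le> A + B"
proof (rule ccontr)
  assume "\<not> b \<le> A + B"
  then have b: "A + B < b" by simp
  then have "A * A \<le> A * b" "(A + B) * b < b * b" using assms(1,2) by (auto intro!: mult_left_mono mult_strict_right_mono)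
  then show False using assms(3) by (simp add: power2_eq_square distrib_right)
qed

lemma (in prob_space) expectation_square_le:
  fixes Y :: "'a \<Rightarrow> real"
  assumes "integrable M Y" "integrable M (\<lambda>x. (Y x)\<^sup>2)"
  shows "(expectation Y)\<^sup>2 \<le> expectation (\<lambda>x. (Y x)\<^sup>2)"
  using variance_eq[OF assms] variance_positive[of Y] by simp

text \<open>The mean \<open>b\<close> of the chaining bound controls both the supremum itself and,
  through the squares, the mean of \<open>S\<close>; it therefore reappears on the right of its own
  estimate, linearly and against \<open>b\<^sup>2\<close> on the left.\<close>

lemma expected_sup_product_le:
  fixes N :: "'i \<Rightarrow> 'a measure" and V s :: real
  assumes N: "\<And>i. prob_space (N i)" and sp: "\<And>i. space (N i) = \<Omega>"
    and I: "finite I" "I \<noteq> {}" and J: "finite J" "J \<noteq> {}"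
    and meas: "\<And>f i. f \<in> J \<Longrightarrow> f \<in> borel_measurable (N i)"
    and bnd: "\<And>f y. f \<in> J \<Longrightarrow> y \<in> \<Omega> \<Longrightarrow> \<bar>f y\<bar> \<le> 1"
    and V: "1 \<le> V" and VC: "VC_subgraph_le \<Omega> J V" and s: "0 < s" "s \<le> 1"
    and var: "\<And>f. f \<in> J \<Longrightarrow> (\<Sum>i\<in>I. (\<integral>y. (f y)\<^sup>2 \<partial>N i)) \<le> real (card I) * s"
  shows "(\<integral>\<^sup>+ x. ennreal (Max ((\<lambda>f. \<bar>\<Sum>i\<in>I. f (x i) - integral\<^sup>L (N i) f\<bar>) ` J)) \<partial>PiM I N)
    \<le> ennreal (4.74 * sqrt (real (card I) * V * s * (9.11 + ln (1 / s))) + 90 * V * (9.11 + ln (1 / s)))"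
proof -
  define n where "n = real (card I)"
  have n: "n > 0" using I by (simp add: n_def card_gt_0_iff)
  define L where "L = 9.11 + ln (1 / s)"
  have u: "ln (1 / s) \<ge> 0" using s by simp
  have L: "L > 0" using u by (simp add: L_def)
  define P where "P = PiM I N"
  interpret P: prob_space P unfolding P_def by (intro prob_space_PiM N)
  have space_P: "x i \<in> \<Omega>" if "x \<in> space P" "i \<in> I" for x i
    using that sp[of i] by (auto simp: P_def space_PiM PiE_def Pi_def)
  have meas_comp: "(\<lambda>x. f (x i)) \<in> borel_measurable P" if "f \<in> J" "i \<in> I" for f i
    unfolding P_def using measurable_compose[OF measurable_component_singleton[OF that(2)] meas[OF that(1)]] .
  define S where "S x = Max ((\<lambda>f. (\<Sum>i\<in>I. (f (x i))\<^sup>2) / n) ` J)" for x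
  define g where "g y = y * (9.11 + ln (1 / y))" for y :: real
  define Y where "Y x = 2.37 * sqrt (n * V * g (S x))" for x
  have Sm[measurable]: "S \<in> borel_measurable P"
    unfolding S_def using J(1)
    by (intro borel_measurable_Max borel_measurable_divide borel_measurable_sum borel_measurable_power meas_comp borel_measurable_const)
  have Ym[measurable]: "Y \<in> borel_measurable P" unfolding Y_def g_def by measurable
  have S_in: "0 \<le> S x \<and> S x \<le> 1" if x: "x \<in> space P" for x
  proof -
    have "S x \<in> (\<lambda>f. (\<Sum>i\<in>I. (f (x i))\<^sup>2) / n) ` J" unfolding S_def using J by (intro Max_in) auto
    then obtain f where f: "f \<in> J" "S x = (\<Sum>i\<in>I. (f (x i))\<^sup>2) / n" by blast
    have "(\<Sum>i\<in>I. (f (x i))\<^sup>2) \<le> (\<Sum>i\<in>I. 1)"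
      using bnd[OF f(1) space_P[OF x]] by (intro sum_mono) (simp add: abs_square_le_1)
    then show ?thesis using n by (simp add: f(2) n_def sum_nonneg)
  qed
  have g0: "0 \<le> g (S x)" and g1: "g (S x) \<le> 10.11" if x: "x \<in> space P" for x
  proof -
    have "0 \<le> ln (1 / S x)" using S_in[OF x] by (cases "S x = 0") auto
    then show "0 \<le> g (S x)" using S_in[OF x] by (simp add: g_def)
    \<comment> \<open>The tangent at 1 gives a crude uniform bound, which serves the integrability
      of \<open>Y\<close> and its square.\<close>
    have "g (S x) \<le> S x * (8.11 + ln (1 / 1)) + 1"
      unfolding g_def using S_in[OF x] by (intro mult_ln_inverse_tangent_le) auto
    then show "g (S x) \<le> 10.11" using S_in[OF x] by simp
  qed
  have Y0: "0 \<le> Y x" if "x \<in> space P" for x using g0[OF that] n V by (simp add: Y_def)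
  have Ysq: "(Y x)\<^sup>2 = 2.37\<^sup>2 * (n * V) * g (S x)" if "x \<in> space P" for x
    unfolding Y_def power_mult_distrib using g0[OF that] n V by simp
  have intS: "integrable P S"
    using S_in by (intro P.integrable_const_bound[where B = 1]) auto
  have intY: "integrable P Y"
  proof (rule P.integrable_const_bound[where B = "2.37 * sqrt (n * V * 10.11)"])
    show "AE x in P. norm (Y x) \<le> 2.37 * sqrt (n * V * 10.11)"
    proof (rule AE_I2)
      fix x assume x: "x \<in> space P"
      have "Y x \<le> 2.37 * sqrt (n * V * 10.11)"
        unfolding Y_def using g1[OF x] n V by (intro mult_left_mono real_sqrt_le_mono) auto
      then show "norm (Y x) \<le> 2.37 * sqrt (n * V * 10.11)" using Y0[OF x] by simp
    qed
  qed measurable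
  have intY2: "integrable P (\<lambda>x. (Y x)\<^sup>2)"
  proof (rule P.integrable_const_bound[where B = "2.37\<^sup>2 * (n * V) * 10.11"])
    show "AE x in P. norm ((Y x)\<^sup>2) \<le> 2.37\<^sup>2 * (n * V) * 10.11"
    proof (rule AE_I2)
      fix x assume x: "x \<in> space P"
      have "(Y x)\<^sup>2 \<le> 2.37\<^sup>2 * (n * V) * 10.11"
        unfolding Ysq[OF x] using g1[OF x] n V by (intro mult_left_mono) auto
      then show "norm ((Y x)\<^sup>2) \<le> 2.37\<^sup>2 * (n * V) * 10.11" by simp
    qed
  qed measurable
  define b where "b = P.expectation Y"
  have b0: "b \<ge> 0" unfolding b_def using Y0 by (intro integral_nonneg_AE AE_I2) auto
  \<comment> \<open>Used for squaring with \<open>l = 2\<close> and for the identity with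
    \<open>l = 1\<close>. The same \<open>Y\<close> serves both, since it depends on the sample only
    through \<open>S\<close>. The 2 comes from symmetrization.\<close>
  have key: "(\<integral>\<^sup>+ x. ennreal (Max ((\<lambda>f. \<bar>\<Sum>i\<in>I. \<phi> (f (x i)) - (\<integral>y. \<phi> (f y) \<partial>N i)\<bar>) ` J)) \<partial>P) \<le> ennreal (2 * l * b)"
    if [measurable]: "\<phi> \<in> borel_measurable borel" and \<phi>0: "\<phi> 0 = 0" and l: "l > 0"
      and lip: "\<And>a b. \<bar>a\<bar> \<le> 1 \<Longrightarrow> \<bar>b\<bar> \<le> 1 \<Longrightarrow> \<bar>\<phi> a - \<phi> b\<bar> \<le> l * \<bar>a - b\<bar>" for \<phi> l
  proof -
    have int: "integrable (N i) (\<lambda>y. \<phi> (f y))" if "f \<in> J" for f i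
    proof -
      interpret Ni: prob_space "N i" by (rule N)
      have "\<bar>\<phi> (f y)\<bar> \<le> l" if "y \<in> space (N i)" for y
      proof -
        have fy: "\<bar>f y\<bar> \<le> 1" using bnd[OF \<open>f \<in> J\<close>] that sp by simp
        have "\<bar>\<phi> (f y)\<bar> \<le> l * \<bar>f y\<bar>" using lip[OF fy, of 0] \<phi>0 by simp
        also have "\<dots> \<le> l * 1" using fy l by (intro mult_left_mono) auto
        finally show ?thesis by simp
      qed
      then show ?thesis using measurable_compose[OF meas[OF \<open>f \<in> J\<close>] \<open>\<phi> \<in> borel_measurable borel\<close>]
        by (intro Ni.integrable_const_bound[where B = l]) auto
    qed
    have "(\<integral>\<^sup>+ x. ennreal (Max ((\<lambda>f. \<bar>0 + (\<Sum>i\<in>I. \<phi> (f (x i)) - (\<integral>y. \<phi> (f y) \<partial>N i))\<bar>) ` J)) \<partial>PiM I N)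
      \<le> (\<integral>\<^sup>+ x. ennreal (rademacher_avg I (\<lambda>\<epsilon>. Max ((\<lambda>f. \<bar>0 + 2 * (\<Sum>i\<in>I. \<epsilon> i * \<phi> (f (x i)))\<bar>) ` J))) \<partial>PiM I N)"
      by (rule symmetrization[where h = "\<lambda>f y. \<phi> (f y)" and c = "\<lambda>_. 0", OF N I(1) J int])
    also have "\<dots> \<le> (\<integral>\<^sup>+ x. ennreal (2 * l * Y x) \<partial>P)"
      unfolding P_def[symmetric]
    proof (intro nn_integral_mono ennreal_leI)
      fix x assume x: "x \<in> space P"
      have "rademacher_avg I (\<lambda>\<epsilon>. Max ((\<lambda>f. \<bar>0 + 2 * (\<Sum>i\<in>I. \<epsilon> i * \<phi> (f (x i)))\<bar>) ` J))
          \<le> rademacher_avg I (\<lambda>\<epsilon>. 2 * Max ((\<lambda>f. \<bar>\<Sum>i\<in>I. \<epsilon> i * \<phi> (f (x i))\<bar>) ` J))"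
      proof (rule rademacher_avg_mono, rule Max.boundedI)
        fix \<epsilon> a assume "a \<in> (\<lambda>f. \<bar>0 + 2 * (\<Sum>i\<in>I. \<epsilon> i * \<phi> (f (x i)))\<bar>) ` J"
        then obtain f where f: "f \<in> J" "a = \<bar>0 + 2 * (\<Sum>i\<in>I. \<epsilon> i * \<phi> (f (x i)))\<bar>" by blast
        have "\<bar>\<Sum>i\<in>I. \<epsilon> i * \<phi> (f (x i))\<bar> \<le> Max ((\<lambda>f. \<bar>\<Sum>i\<in>I. \<epsilon> i * \<phi> (f (x i))\<bar>) ` J)"
          using J f(1) by (intro Max_ge) auto
        then show "a \<le> 2 * Max ((\<lambda>f. \<bar>\<Sum>i\<in>I. \<epsilon> i * \<phi> (f (x i))\<bar>) ` J)" by (simp add: f(2) abs_mult)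
      qed (use J in auto)
      also have "\<dots> = 2 * rademacher_avg I (\<lambda>\<epsilon>. Max ((\<lambda>f. \<bar>\<Sum>i\<in>I. \<epsilon> i * \<phi> (f (x i))\<bar>) ` J))"
        by (rule rademacher_avg_cmult)
      also have "rademacher_avg I (\<lambda>\<epsilon>. Max ((\<lambda>f. \<bar>\<Sum>i\<in>I. \<epsilon> i * \<phi> (f (x i))\<bar>) ` J)) \<le> l * Y x"
        unfolding Y_def g_def S_def n_def
        by (rule rademacher_avg_VC_subgraph_le[OF I space_P[OF x] J VC V _ \<phi>0 l lip]) (use bnd space_P[OF x] in auto)
      finally show "rademacher_avg I (\<lambda>\<epsilon>. Max ((\<lambda>f. \<bar>0 + 2 * (\<Sum>i\<in>I. \<epsilon> i * \<phi> (f (x i)))\<bar>) ` J)) \<le> 2 * l * Y x" by simp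
    qed
    also have "\<dots> = ennreal (P.expectation (\<lambda>x. 2 * l * Y x))"
      using intY Y0 l by (intro nn_integral_eq_integral AE_I2) auto
    also have "P.expectation (\<lambda>x. 2 * l * Y x) = 2 * l * b" by (simp add: b_def)
    finally show ?thesis by (simp add: P_def)
  qed
  have ES: "P.expectation S \<le> s + 4 * b / n"
  proof -
    \<comment> \<open>The excess of \<open>n * S\<close> over \<open>n * s\<close> is at most this
      centred supremum, whose mean is at most \<open>4 * b\<close>: 2 from symmetrization, 2 from
      the Lipschitz constant of squaring on [-1,1].\<close>
    define W where "W x = Max ((\<lambda>f. \<bar>\<Sum>i\<in>I. (f (x i))\<^sup>2 - (\<integral>y. (f y)\<^sup>2 \<partial>N i)\<bar>) ` J)" for x
    have Wm[measurable]: "W \<in> borel_measurable P"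
      unfolding W_def using J(1)
      by (intro borel_measurable_Max borel_measurable_abs borel_measurable_sum borel_measurable_diff borel_measurable_power meas_comp borel_measurable_const)
    have W0: "0 \<le> W x" for x unfolding W_def by (rule Max_abs_nonneg[OF J])
    have "\<bar>a\<^sup>2 - b\<^sup>2\<bar> \<le> 2 * \<bar>a - b\<bar>" if "\<bar>a\<bar> \<le> 1" "\<bar>b\<bar> \<le> 1" for a b :: real
    proof -
      have "\<bar>a\<^sup>2 - b\<^sup>2\<bar> = \<bar>a + b\<bar> * \<bar>a - b\<bar>" by (simp add: abs_mult[symmetric] power2_eq_square algebra_simps)
      also have "\<dots> \<le> 2 * \<bar>a - b\<bar>" using that by (intro mult_right_mono) auto
      finally show ?thesis .
    qed
    then have W: "(\<integral>\<^sup>+ x. ennreal (W x) \<partial>P) \<le> ennreal (2 * 2 * b)"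
      unfolding W_def by (intro key) auto
    have SW: "S x \<le> s + W x / n" if x: "x \<in> space P" for x
      unfolding S_def
    proof (rule Max.boundedI)
      fix a assume "a \<in> (\<lambda>f. (\<Sum>i\<in>I. (f (x i))\<^sup>2) / n) ` J"
      then obtain f where f: "f \<in> J" "a = (\<Sum>i\<in>I. (f (x i))\<^sup>2) / n" by blast
      have "(\<Sum>i\<in>I. (f (x i))\<^sup>2 - (\<integral>y. (f y)\<^sup>2 \<partial>N i)) \<le> W x"
        unfolding W_def using J f(1) by (intro order_trans[OF abs_ge_self Max_ge]) auto
      then have "(\<Sum>i\<in>I. (f (x i))\<^sup>2) \<le> n * s + W x"
        using var[OF f(1)] by (simp add: sum_subtractf n_def)
      then show "a \<le> s + W x / n" using n by (simp add: f(2) field_simps)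
    qed (use J in auto)
    have "ennreal (P.expectation S) = (\<integral>\<^sup>+ x. ennreal (S x) \<partial>P)"
      using intS S_in by (intro nn_integral_eq_integral[symmetric] AE_I2) auto
    also have "\<dots> \<le> (\<integral>\<^sup>+ x. ennreal s + ennreal (1 / n) * ennreal (W x) \<partial>P)"
    proof (rule nn_integral_mono)
      fix x assume "x \<in> space P"
      then have "ennreal (S x) \<le> ennreal (s + 1 / n * W x)" using SW by (intro ennreal_leI) auto
      also have "\<dots> = ennreal s + ennreal (1 / n) * ennreal (W x)"
        using s n W0[of x] ennreal_mult[of "1 / n" "W x"] by (subst ennreal_plus) auto
      finally show "ennreal (S x) \<le> \<dots>" .
    qed
    also have "\<dots> = ennreal s + ennreal (1 / n) * (\<integral>\<^sup>+ x. ennreal (W x) \<partial>P)"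
      by (subst nn_integral_add) (simp_all add: nn_integral_cmult P.emeasure_space_1)
    also have "\<dots> \<le> ennreal s + ennreal (1 / n) * ennreal (2 * 2 * b)"
      using W by (intro add_left_mono mult_left_mono) auto
    also have "\<dots> = ennreal (s + 1 / n * (2 * 2 * b))"
      using s n b0 ennreal_mult[of "1 / n" "2 * 2 * b"] by (subst ennreal_plus) auto
    finally have "P.expectation S \<le> s + 1 / n * (2 * 2 * b)"
      using s n b0 by (subst (asm) ennreal_le_iff) auto
    then show ?thesis by simp
  qed
  have "b\<^sup>2 \<le> P.expectation (\<lambda>x. (Y x)\<^sup>2)" unfolding b_def by (rule P.expectation_square_le[OF intY intY2])
  also have "\<dots> \<le> P.expectation (\<lambda>x. 2.37\<^sup>2 * (n * V) * (S x * (L - 1) + s))"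
  proof (rule integral_mono_AE[OF intY2])
    show "integrable P (\<lambda>x. 2.37\<^sup>2 * (n * V) * (S x * (L - 1) + s))" using intS by auto
    show "AE x in P. (Y x)\<^sup>2 \<le> 2.37\<^sup>2 * (n * V) * (S x * (L - 1) + s)"
    proof (rule AE_I2)
      fix x assume x: "x \<in> space P"
      \<comment> \<open>Taking the tangent at the deterministic \<open>s\<close> makes the bound
        affine in \<open>S x\<close>, so integration leaves only the mean of
        \<open>S\<close>.\<close>
      have "g (S x) \<le> S x * (8.11 + ln (1 / s)) + s"
        unfolding g_def using S_in[OF x] s by (intro mult_ln_inverse_tangent_le) auto
      also have "8.11 + ln (1 / s) = L - 1" by (simp add: L_def)
      finally show "(Y x)\<^sup>2 \<le> 2.37\<^sup>2 * (n * V) * (S x * (L - 1) + s)"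
        unfolding Ysq[OF x] using n V by (intro mult_left_mono) auto
    qed
  qed
  also have "\<dots> = 2.37\<^sup>2 * (n * V) * (P.expectation S * (L - 1) + s)"
    using intS by (simp add: P.prob_space)
  also have "\<dots> \<le> 2.37\<^sup>2 * (n * V) * ((s + 4 * b / n) * (L - 1) + s)"
    using ES n V u by (intro mult_left_mono add_right_mono mult_right_mono) (auto simp: L_def)
  also have "\<dots> = 2.37\<^sup>2 * (n * V * s * L) + 2.37\<^sup>2 * 4 * V * (L - 1) * b"
    using n by (simp add: field_simps)
  also have "\<dots> \<le> 2.37\<^sup>2 * (n * V * s * L) + 2.37\<^sup>2 * 4 * V * L * b"
    using V b0 by (intro add_left_mono mult_right_mono mult_left_mono) auto
  also have "2.37\<^sup>2 * (n * V * s * L) = (2.37 * sqrt (n * V * s * L))\<^sup>2"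
    unfolding power_mult_distrib using n V s L by simp
  finally have sq: "b\<^sup>2 \<le> (2.37 * sqrt (n * V * s * L))\<^sup>2 + 2.37\<^sup>2 * 4 * V * L * b" .
  have "b \<le> 2.37 * sqrt (n * V * s * L) + 2.37\<^sup>2 * 4 * V * L"
    by (rule le_add_of_square_le[OF _ _ sq]) (use n V s L in simp_all)
  \<comment> \<open>Here 4 * 2.37^2 is about 22.5, well below 45; the factor 2 of symmetrization
    then gives 4.74 and 90.\<close>
  moreover have "2.37\<^sup>2 * 4 * V * L \<le> 45 * V * L"
    using V L by (intro mult_right_mono) (auto simp: power2_eq_square)
  ultimately have "2 * 1 * b \<le> 4.74 * sqrt (n * V * s * L) + 90 * V * L" by simp
  then have "ennreal (2 * 1 * b) \<le> ennreal (4.74 * sqrt (n * V * s * L) + 90 * V * L)" by (rule ennreal_leI)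
  moreover have "(\<integral>\<^sup>+ x. ennreal (Max ((\<lambda>f. \<bar>\<Sum>i\<in>I. f (x i) - integral\<^sup>L (N i) f\<bar>) ` J)) \<partial>P) \<le> ennreal (2 * 1 * b)"
    by (rule key[of "\<lambda>a. a"]) auto
  ultimately show ?thesis unfolding P_def n_def L_def by (rule order_trans[rotated])
qed

section \<open>From finite to countable classes, and from the product space to the sample\<close>

lemma SUP_ennreal_eq_SUP_Max:
  fixes z :: "nat \<Rightarrow> real"
  shows "(SUP k. ennreal (z k)) = (SUP K. ennreal (Max (z ` {..K})))"
proof (rule antisym)
  show "(SUP k. ennreal (z k)) \<le> (SUP K. ennreal (Max (z ` {..K})))"
    by (intro SUP_mono bexI[of _ "_::nat"] ennreal_leI Max_ge) auto
  show "(SUP K. ennreal (Max (z ` {..K}))) \<le> (SUP k. ennreal (z k))"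
  proof (rule SUP_least)
    fix K :: nat
    have "Max (z ` {..K}) \<in> z ` {..K}" by (intro Max_in) auto
    then obtain k where k: "Max (z ` {..K}) = z k" by blast
    show "ennreal (Max (z ` {..K})) \<le> (SUP k. ennreal (z k))" unfolding k by (intro SUP_upper UNIV_I)
  qed
qed

text \<open>An enumeration of \<open>F\<close> turns the supremum into an increasing limit of maxima
  over initial segments; monotone convergence then carries over any bound uniform in the finite
  subclasses.\<close>

lemma nn_integral_SUP_countable_le:
  fixes z :: "'f \<Rightarrow> 'a \<Rightarrow> real"
  assumes F: "countable F" "F \<noteq> {}" and z: "\<And>f. f \<in> F \<Longrightarrow> z f \<in> borel_measurable M"
    and le: "\<And>J. finite J \<Longrightarrow> J \<noteq> {} \<Longrightarrow> J \<subseteq> F \<Longrightarrow> (\<integral>\<^sup>+ x. ennreal (Max ((\<lambda>f. z f x) ` J)) \<partial>M) \<le> B"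
  shows "(\<integral>\<^sup>+ x. (SUP f\<in>F. ennreal (z f x)) \<partial>M) \<le> B"
proof -
  define e where "e = from_nat_into F"
  have F_eq: "F = range e" unfolding e_def using F by (simp add: range_from_nat_into)
  have eF: "e k \<in> F" for k by (simp add: F_eq)
  have "(SUP f\<in>F. ennreal (z f x)) = (SUP K. ennreal (Max ((\<lambda>f. z f x) ` e ` {..K})))" for x
    unfolding F_eq image_image using SUP_ennreal_eq_SUP_Max[of "\<lambda>k. z (e k) x"] by simp
  then have "(\<integral>\<^sup>+ x. (SUP f\<in>F. ennreal (z f x)) \<partial>M) = (\<integral>\<^sup>+ x. (SUP K. ennreal (Max ((\<lambda>f. z f x) ` e ` {..K}))) \<partial>M)"
    by simp
  also have "\<dots> = (SUP K. \<integral>\<^sup>+ x. ennreal (Max ((\<lambda>f. z f x) ` e ` {..K})) \<partial>M)"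
  proof (rule nn_integral_monotone_convergence_SUP)
    show "incseq (\<lambda>K x. ennreal (Max ((\<lambda>f. z f x) ` e ` {..K})))"
      by (intro incseq_SucI le_funI ennreal_leI Max_mono image_mono) auto
    show "(\<lambda>x. ennreal (Max ((\<lambda>f. z f x) ` e ` {..K}))) \<in> borel_measurable M" for K
      using z eF by (intro measurable_compose[OF _ measurable_ennreal] borel_measurable_Max) auto
  qed
  also have "\<dots> \<le> B"
    using eF by (intro SUP_least le) auto
  finally show ?thesis .
qed

theorem theorem2:
  fixes M :: "'b measure" and Xs :: "'a measure"
    and X :: "nat \<Rightarrow> 'b \<Rightarrow> 'a" and n :: nat
    and F :: "('a \<Rightarrow> real) set" and V \<sigma> :: real
  assumes "prob_space M"
    and "prob_space.indep_vars M (\<lambda>_. Xs) X {1..n}"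
    and "countable F"
    and "\<And>f. f \<in> F \<Longrightarrow> f \<in> borel_measurable Xs"
    and "\<And>f x. f \<in> F \<Longrightarrow> x \<in> space Xs \<Longrightarrow> -1 \<le> f x \<and> f x \<le> 1"
    and "V \<ge> 1"
    and "VC_subgraph_le (space Xs) F V"
    and "0 < \<sigma>" and "\<sigma> \<le> 1"
    and "\<And>f. f \<in> F \<Longrightarrow>
           (1 / real n) * (\<Sum>i\<in>{1..n}. prob_space.expectation M (\<lambda>\<omega>. (f (X i \<omega>))\<^sup>2)) \<le> \<sigma>\<^sup>2"
  shows "(\<integral>\<^sup>+ \<omega>. (\<Squnion>f\<in>F. ennreal \<bar>\<Sum>i\<in>{1..n}. f (X i \<omega>) - prob_space.expectation M (\<lambda>\<eta>. f (X i \<eta>))\<bar>) \<partial>M)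
         \<le> ennreal (4.74 * sqrt (real n * V * \<sigma>\<^sup>2 * (9.11 + ln (1 / \<sigma>\<^sup>2)))
                    + 90 * V * (9.11 + ln (1 / \<sigma>\<^sup>2)))"
proof -
  interpret M: prob_space M by fact
  define I where "I = {1..n}"
  define L where "L = 9.11 + ln (1 / \<sigma>\<^sup>2)"
  define z where "z f \<omega> = \<bar>\<Sum>i\<in>I. f (X i \<omega>) - M.expectation (\<lambda>\<eta>. f (X i \<eta>))\<bar>" for f :: "'a \<Rightarrow> real" and \<omega>
  define B where "B = ennreal (4.74 * sqrt (real n * V * \<sigma>\<^sup>2 * L) + 90 * V * L)"
  have X[measurable]: "X i \<in> measurable M Xs" if "i \<in> I" for i
    using assms(2) that unfolding I_def M.indep_vars_def by auto
  have fX[measurable]: "(\<lambda>\<omega>. f (X i \<omega>)) \<in> borel_measurable M" if "f \<in> F" "i \<in> I" for f i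
    using measurable_compose[OF X[OF that(2)] assms(4)[OF that(1)]] .
  have "(\<integral>\<^sup>+ \<omega>. (SUP f\<in>F. ennreal (z f \<omega>)) \<partial>M) \<le> B"
  \<comment> \<open>In the degenerate cases the sum is empty, or the supremum over the empty class
    is 0 in \<open>ennreal\<close>. Otherwise index 1 belongs to \<open>I\<close>, which is used for
    a default value below.\<close>
  proof (cases "n = 0 \<or> F = {}")
    case True
    then have "(SUP f\<in>F. ennreal (z f \<omega>)) = 0" for \<omega>
      by (auto simp: z_def I_def bot_ennreal[symmetric] SUP_constant)
    then show ?thesis by simp
  next
    case False
    then have n: "n > 0" and F: "F \<noteq> {}" by auto
    then have I: "finite I" "I \<noteq> {}" "1 \<in> I" and cardI: "card I = n" by (auto simp: I_def)
    show ?thesis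
    proof (rule nn_integral_SUP_countable_le[OF assms(3) F])
      show "z f \<in> borel_measurable M" if "f \<in> F" for f
        unfolding z_def using fX[OF that] by measurable
      fix J assume J: "finite J" "J \<noteq> {}" "J \<subseteq> F"
      \<comment> \<open>Outside \<open>I\<close> the law of \<open>X 1\<close> is a dummy: the
        product estimate asks for a probability measure at every index.\<close>
      define N where "N i = distr M Xs (X (if i \<in> I then i else 1))" for i
      have XN: "X (if i \<in> I then i else 1) \<in> measurable M Xs" for i using X I(3) by auto
      have N: "prob_space (N i)" for i unfolding N_def by (rule M.prob_space_distr[OF XN])
      have setsN: "sets (N i) = sets Xs" for i by (simp add: N_def)
      \<comment> \<open>Independence in product form: the joint law of the restricted sample is the
        product of its marginals, so the product-space bound applies to the original
        variables.\<close>
      have PN: "PiM I N = distr M (PiM I (\<lambda>_. Xs)) (\<lambda>\<omega>. \<lambda>i\<in>I. X i \<omega>)"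
      proof -
        have "PiM I N = PiM I (\<lambda>i. distr M Xs (X i))" by (intro PiM_cong) (auto simp: N_def)
        also have "\<dots> = distr M (PiM I (\<lambda>_. Xs)) (\<lambda>\<omega>. \<lambda>i\<in>I. X i \<omega>)"
          using M.indep_vars_iff_distr_eq_PiM'[OF I(2), of X "\<lambda>_. Xs"] X assms(2) unfolding I_def by auto
        finally show ?thesis .
      qed
      have integral_N: "integral\<^sup>L (N i) h = M.expectation (\<lambda>\<eta>. h (X i \<eta>))"
        if "i \<in> I" "h \<in> borel_measurable Xs" for i and h :: "'a \<Rightarrow> real"
        using that X[OF that(1)] by (simp add: N_def integral_distr)
      have meas: "f \<in> borel_measurable Xs" if "f \<in> J" for f using assms(4) J(3) that by auto
      have f2: "(\<lambda>y. (f y)\<^sup>2) \<in> borel_measurable Xs" if "f \<in> J" for f using meas[OF that] by measurable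
      have meas_comp: "(\<lambda>x. f (x i)) \<in> borel_measurable (PiM I (\<lambda>_. Xs))" if "f \<in> J" "i \<in> I" for f i
        using measurable_compose[OF measurable_component_singleton[OF that(2), of "\<lambda>_. Xs"] meas[OF that(1)]] .
      define H where "H x = ennreal (Max ((\<lambda>f. \<bar>\<Sum>i\<in>I. f (x i) - integral\<^sup>L (N i) f\<bar>) ` J))" for x
      have Hm: "H \<in> borel_measurable (PiM I (\<lambda>_. Xs))"
        unfolding H_def using J(1)
        by (intro measurable_compose[OF _ measurable_ennreal] borel_measurable_Max borel_measurable_abs
            borel_measurable_sum borel_measurable_diff borel_measurable_const
            meas_comp)
      have "(\<integral>\<^sup>+ \<omega>. ennreal (Max ((\<lambda>f. z f \<omega>) ` J)) \<partial>M) = (\<integral>\<^sup>+ \<omega>. H (\<lambda>i\<in>I. X i \<omega>) \<partial>M)"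
      proof (rule nn_integral_cong)
        fix \<omega>
        have "(\<lambda>f. z f \<omega>) ` J = (\<lambda>f. \<bar>\<Sum>i\<in>I. f ((\<lambda>i\<in>I. X i \<omega>) i) - integral\<^sup>L (N i) f\<bar>) ` J"
        proof (rule image_cong[OF refl])
          fix f assume f: "f \<in> J"
          have "(\<Sum>i\<in>I. f (X i \<omega>) - M.expectation (\<lambda>\<eta>. f (X i \<eta>)))
              = (\<Sum>i\<in>I. f ((\<lambda>i\<in>I. X i \<omega>) i) - integral\<^sup>L (N i) f)"
            by (intro sum.cong refl) (simp add: integral_N meas f)
          then show "z f \<omega> = \<bar>\<Sum>i\<in>I. f ((\<lambda>i\<in>I. X i \<omega>) i) - integral\<^sup>L (N i) f\<bar>" by (simp only: z_def)
        qed
        then show "ennreal (Max ((\<lambda>f. z f \<omega>) ` J)) = H (\<lambda>i\<in>I. X i \<omega>)" by (simp only: H_def)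
      qed
      also have "\<dots> = (\<integral>\<^sup>+ x. H x \<partial>PiM I N)"
        unfolding PN by (rule nn_integral_distr[OF measurable_restrict[OF X], symmetric]) (simp_all add: Hm)
      also have "\<dots> \<le> ennreal (4.74 * sqrt (real (card I) * V * \<sigma>\<^sup>2 * (9.11 + ln (1 / \<sigma>\<^sup>2))) + 90 * V * (9.11 + ln (1 / \<sigma>\<^sup>2)))"
        unfolding H_def
      proof (rule expected_sup_product_le[OF N _ I(1,2) J(1,2)])
        show "space (N i) = space Xs" for i by (simp add: N_def)
        show "f \<in> borel_measurable (N i)" if "f \<in> J" for f i
          using meas[OF that] setsN by (simp cong: measurable_cong_sets)
        show "\<bar>f y\<bar> \<le> 1" if "f \<in> J" "y \<in> space Xs" for f y
          using assms(5)[OF subsetD[OF J(3) that(1)] that(2)] by (simp add: abs_le_iff)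
        show "VC_subgraph_le (space Xs) J V" using assms(7) J(3) by (rule VC_subgraph_le_subset)
        show "0 < \<sigma>\<^sup>2" "\<sigma>\<^sup>2 \<le> 1" "1 \<le> V" using assms by (auto simp: power_le_one)
        fix f assume f: "f \<in> J"
        have "(\<Sum>i\<in>I. \<integral>y. (f y)\<^sup>2 \<partial>N i) = (\<Sum>i\<in>I. M.expectation (\<lambda>\<omega>. (f (X i \<omega>))\<^sup>2))"
          using f2[OF f] by (intro sum.cong refl integral_N) auto
        also have "\<dots> \<le> real (card I) * \<sigma>\<^sup>2"
          using assms(10)[of f] f J(3) n unfolding cardI I_def by (auto simp: field_simps)
        finally show "(\<Sum>i\<in>I. \<integral>y. (f y)\<^sup>2 \<partial>N i) \<le> real (card I) * \<sigma>\<^sup>2" .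
      qed
      finally show "(\<integral>\<^sup>+ \<omega>. ennreal (Max ((\<lambda>f. z f \<omega>) ` J)) \<partial>M) \<le> B"
        unfolding B_def L_def cardI .
    qed
  qed
  then show ?thesis unfolding z_def I_def B_def L_def .
qed

end
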